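(* Let $M$ be either the unit sphere $\mathbb{S}^2$ or the hyperbolic plane $\mathbb{H}^2$ (curvature $-1$), let $R>0$ and $\alpha$ be given, and assume that the circle of radius $R$ in $M$ admits a non-trivial infinitesimal deformation through Gutkin curves with contact angle $\alpha$. Define the angle $c$ by $$\cot c=\cos R\,\cot\alpha\quad\text{(spherical case)},\qquad \cot c=\cosh R\,\cot\alpha\quad\text{(hyperbolic case)}.$$ Then there exists an integer $k\ge 2$ such that $$k\tan c=\tan(kc).$$
   Context: Let $C$ be a smooth, convex, oriented closed curve in $M$ ($M=\mathbb{S}^2$ or $\mathbb{H}^2$). For distinct points $x,y\in C$ let $|xy|$ be the oriented geodesic chord from $x$ to $y$. $C$ is a Gutkin curve with contact angle $\alpha\in(0,\pi]$ if there are parameterizations $x(t),y(t)$ of $C$ with $x'(t)>0$, $y'(t)>0$ (with respect to the orientation), $x(t)\neq y(t)$ for all $t$, such that for every $t$ both angles between $C$ and the chord $|x(t)y(t)|$ equal $\alpha$: at $x(t)$ the angle between the positively oriented tangent of $C$ and the direction of the chord towards $y(t)$, and at $y(t)$ the angle between the direction of the chord (from $x(t)$ towards $y(t)$) and the positively oriented tangent of $C$. Every circle is a Gutkin curve. An infinitesimal deformation of a circle $\gamma_0$ through Gutkin curves with contact angle $\alpha$ is a family of smooth closed convex curves $\gamma_\varepsilon$ with chord parameterizations $x_\varepsilon(t),y_\varepsilon(t)$, depending smoothly on $\varepsilon$ and equal to $\gamma_0$ at $\varepsilon=0$, for which the Gutkin property with the same contact angle $\alpha$ holds to first order in $\varepsilon$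 (i.e. modulo $O(\varepsilon^2)$). It is non-trivial if it does not correspond (to first order) to a deformation through circles, i.e. the first-order variation of the geodesic curvature of $\gamma_\varepsilon$, as a function along the curve, is not constant. *)

theory Defs
  imports "HOL-Analysis.Analysis"
begin

text \<open>The two model geometries: the unit sphere S^2 in R^3 (Euclidean inner product)
  and the hyperbolic plane H^2 of curvature -1 (upper sheet of the hyperboloid
  in Minkowski space R^{2,1}).\<close>

datatype geom = Sphere | Hyperbolic

definition sg :: "geom \<Rightarrow> real" where
  "sg g = (case g of Sphere \<Rightarrow> 1 | Hyperbolic \<Rightarrow> -1)"

definition ip :: "geom \<Rightarrow> real^3 \<Rightarrow> real^3 \<Rightarrow> real" where
  "ip g u v = u$1 * v$1 + u$2 * v$2 + sg g * (u$3 * v$3)"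

definition model :: "geom \<Rightarrow> (real^3) set" where
  "model g = (case g of Sphere \<Rightarrow> {p. ip g p p = 1}
                      | Hyperbolic \<Rightarrow> {p. ip g p p = -1 \<and> p$3 > 0})"

definition mdist :: "geom \<Rightarrow> real^3 \<Rightarrow> real^3 \<Rightarrow> real" where
  "mdist g p q = (case g of Sphere \<Rightarrow> arccos (ip g p q)
                          | Hyperbolic \<Rightarrow> arcosh (- ip g p q))"

definition mcircle :: "geom \<Rightarrow> real^3 \<Rightarrow> real \<Rightarrow> (real^3) set" where
  "mcircle g c R = {p \<in> model g. mdist g p c = R}"

definition mnorm :: "geom \<Rightarrow> real^3 \<Rightarrow> real" where
  "mnorm g v = sqrt (ip g v v)"

definition mangle :: "geom \<Rightarrow> real^3 \<Rightarrow> real^3 \<Rightarrow> real" where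
  "mangle g u v = arccos (ip g u v / (mnorm g u * mnorm g v))"

text \<open>Initial direction at x of the geodesic from x towards y (projection of y
  onto the tangent plane T_x M).\<close>
definition chord_dir :: "geom \<Rightarrow> real^3 \<Rightarrow> real^3 \<Rightarrow> real^3" where
  "chord_dir g x y = y - (ip g x y / ip g x x) *\<^sub>R x"

definition det3 :: "real^3 \<Rightarrow> real^3 \<Rightarrow> real^3 \<Rightarrow> real" where
  "det3 u v w = u$1 * (v$2 * w$3 - v$3 * w$2) - u$2 * (v$1 * w$3 - v$3 * w$1)
              + u$3 * (v$1 * w$2 - v$2 * w$1)"

coinductive smooth_fun :: "('a::real_normed_vector \<Rightarrow> 'b::real_normed_vector) \<Rightarrow> bool" where
  "(\<forall>x. (f has_derivative D x) (at x)) \<Longrightarrow> (\<forall>v. smooth_fun (\<lambda>x. D x v)) \<Longrightarrow> smooth_fun f"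

definition d_s :: "(real \<Rightarrow> real \<Rightarrow> real^3) \<Rightarrow> real \<Rightarrow> real \<Rightarrow> real^3" where
  "d_s G e s = vector_derivative (\<lambda>s'. G e s') (at s)"

definition dd_s :: "(real \<Rightarrow> real \<Rightarrow> real^3) \<Rightarrow> real \<Rightarrow> real \<Rightarrow> real^3" where
  "dd_s G e s = vector_derivative (\<lambda>s'. d_s G e s') (at s)"

text \<open>Geodesic curvature of the curve s \<mapsto> G e s (up to a global sign fixed by the
  orientation convention): det(gamma, gamma', gamma'') / |gamma'|^3, valid in both models.\<close>
definition gcurv :: "geom \<Rightarrow> (real \<Rightarrow> real \<Rightarrow> real^3) \<Rightarrow> real \<Rightarrow> real \<Rightarrow> real" where
  "gcurv g G e s = det3 (G e s) (d_s G e s) (dd_s G e s) / (mnorm g (d_s G e s)) ^ 3"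

text \<open>Angle at x(t) between the positive tangent and the chord towards y(t), and
  angle at y(t) between the chord direction (from x towards y) and the positive tangent.\<close>
definition angle_x :: "geom \<Rightarrow> (real \<Rightarrow> real \<Rightarrow> real^3) \<Rightarrow> (real \<Rightarrow> real \<Rightarrow> real)
     \<Rightarrow> (real \<Rightarrow> real \<Rightarrow> real) \<Rightarrow> real \<Rightarrow> real \<Rightarrow> real" where
  "angle_x g G \<phi> \<psi> e t =
     mangle g (d_s G e (\<phi> e t)) (chord_dir g (G e (\<phi> e t)) (G e (\<psi> e t)))"

definition angle_y :: "geom \<Rightarrow> (real \<Rightarrow> real \<Rightarrow> real^3) \<Rightarrow> (real \<Rightarrow> real \<Rightarrow> real)
     \<Rightarrow> (real \<Rightarrow> real \<Rightarrow> real) \<Rightarrow> real \<Rightarrow> real \<Rightarrow> real" where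
  "angle_y g G \<phi> \<psi> e t =
     mangle g (- chord_dir g (G e (\<psi> e t)) (G e (\<phi> e t))) (d_s G e (\<psi> e t))"

text \<open>A family of smooth, closed, simple, regular, (locally strictly) convex curves
  s \<mapsto> G e s (2pi-periodic in s) for |e| < \<delta>, with chord parameterizations
  x_e(t) = G e (\<phi> e t), y_e(t) = G e (\<psi> e t), everything smooth in (e,s) resp. (e,t),
  which is a circle of radius R at e = 0 and is Gutkin with contact angle \<alpha> modulo O(e^2);
  non-trivial: the first variation of geodesic curvature is not constant along the curve.\<close>
definition nontrivial_inf_gutkin_deformation ::
  "geom \<Rightarrow> real \<Rightarrow> real \<Rightarrow> bool" where
  "nontrivial_inf_gutkin_deformation g R \<alpha> \<longleftrightarrow>
   (\<exists>(G :: real \<Rightarrow> real \<Rightarrow> real^3) (\<phi> :: real \<Rightarrow> real \<Rightarrow> real) (\<psi> :: real \<Rightarrow> real \<Rightarrow> real)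
      (\<delta>::real) (C::real) (c::real^3).
      \<delta> > 0 \<and>
      smooth_fun (\<lambda>(e, s). G e s) \<and> smooth_fun (\<lambda>(e, t). \<phi> e t) \<and> smooth_fun (\<lambda>(e, t). \<psi> e t) \<and>
      (\<forall>e s. \<bar>e\<bar> < \<delta> \<longrightarrow>
         G e s \<in> model g \<and> G e (s + 2 * pi) = G e s \<and>
         mnorm g (d_s G e s) > 0 \<and> gcurv g G e s \<noteq> 0) \<and>
      (\<forall>e s1 s2. \<bar>e\<bar> < \<delta> \<longrightarrow> s1 \<in> {0..<2*pi} \<longrightarrow> s2 \<in> {0..<2*pi} \<longrightarrow>
         G e s1 = G e s2 \<longrightarrow> s1 = s2) \<and>
      (\<forall>e t. \<bar>e\<bar> < \<delta> \<longrightarrow>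
         deriv (\<lambda>t'. \<phi> e t') t > 0 \<and> deriv (\<lambda>t'. \<psi> e t') t > 0 \<and>
         \<phi> e (t + 2 * pi) = \<phi> e t + 2 * pi \<and> \<psi> e (t + 2 * pi) = \<psi> e t + 2 * pi \<and>
         G e (\<phi> e t) \<noteq> G e (\<psi> e t)) \<and>
      (\<forall>e t. \<bar>e\<bar> < \<delta> \<longrightarrow>
         \<bar>angle_x g G \<phi> \<psi> e t - \<alpha>\<bar> \<le> C * e\<^sup>2 \<and>
         \<bar>angle_y g G \<phi> \<psi> e t - \<alpha>\<bar> \<le> C * e\<^sup>2) \<and>
      c \<in> model g \<and> range (G 0) = mcircle g c R \<and>
      (\<exists>s1 s2. deriv (\<lambda>e. gcurv g G e s1) 0 \<noteq> deriv (\<lambda>e. gcurv g G e s2) 0))"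

end

theory Submission
  imports Defs
begin

text \<open>
  Write the curves in polar form around the centre of the circle and let \<open>p(u)\<close> be the normal
  component of the deformation at the point with angle \<open>u\<close>. On the unperturbed circle all chords
  have the same central angle \<open>\<beta>\<close>, and \<open>\<gamma> = \<beta> / 2\<close> satisfies \<open>cot \<gamma> = m\<close> with
  \<open>m = \<bar>cos R\<bar> cot \<alpha>\<close> or \<open>cosh R cot \<alpha>\<close>. Subtracting the first variations of the two contact angles
  eliminates the tangential components and the variation of the chord length, and leaves
  \<open>p'(u) + p'(u + \<beta>) = m (p(u + \<beta>) - p(u))\<close>.
  Hence a Fourier coefficient of \<open>p\<close> of order \<open>k\<close> vanishes unless \<open>k cos (k\<gamma>) = m sin (k\<gamma>)\<close>. The first
  variation of the curvature is a multiple of \<open>p'' + p\<close>, which is constant if only the orders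
  \<open>0\<close> and \<open>1\<close> occur.
\<close>

section \<open>Smooth two-parameter families\<close>

text \<open>The tangential components disappear for a geometric reason. The two cosines have the
  same denominator, so equality of the angles means that
  \<open>ip g \<tau>x y + ip g x \<tau>y\<close> vanishes. On a circle this sum is zero for every
  pair of points; hence moving the end points along the circle changes nothing, and only p is felt.
  The value of \<alpha> enters at order zero alone, where it fixes \<beta>. Three obstacles shape
  the rest. The circle comes with an arbitrary regular parametrisation, in either direction, so p
  becomes a function of the angle only after an increasing angle function has been found and
  inverted. Contact angles are values of \<open>arccos\<close> and see only the absolute value of
  the height h of the circle, cos R or cosh R, while the claim contains h itself. A great circle, h
  = 0, puts no first-order condition on p; there cot c = 0, which is settled separately.\<close>

lemma smooth_fun_partials:
  fixes G :: "real \<Rightarrow> real \<Rightarrow> 'b::real_normed_vector"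
  assumes "smooth_fun (\<lambda>(e, s). G e s)"
  obtains Ge Gs where "smooth_fun (\<lambda>(e, s). Ge e s)" "smooth_fun (\<lambda>(e, s). Gs e s)"
    "\<And>e s. ((\<lambda>(e, s). G e s) has_derivative (\<lambda>(a, b). a *\<^sub>R Ge e s + b *\<^sub>R Gs e s)) (at (e, s))"
proof -
  from assms obtain D where D: "\<And>x. ((\<lambda>(e, s). G e s) has_derivative D x) (at x)"
    and sm: "\<And>v. smooth_fun (\<lambda>x. D x v)"
    by (cases rule: smooth_fun.cases) auto
  have lin: "D x (a, b) = a *\<^sub>R D x (1, 0) + b *\<^sub>R D x (0, 1)" for x a b
  proof -
    interpret bounded_linear "D x" using D has_derivative_bounded_linear by blast
    have "D x (a, b) = D x (a *\<^sub>R (1, 0) + b *\<^sub>R (0, 1))" by simp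
    then show ?thesis unfolding add scale .
  qed
  show ?thesis
  proof (rule that[of "\<lambda>e s. D (e, s) (1, 0)" "\<lambda>e s. D (e, s) (0, 1)"])
    show "((\<lambda>(e, s). G e s) has_derivative
        (\<lambda>(a, b). a *\<^sub>R D (e, s) (1, 0) + b *\<^sub>R D (e, s) (0, 1))) (at (e, s))" for e s
      using D[of "(e, s)"]
      by (rule has_derivative_eq_rhs) (simp add: fun_eq_iff lin[of "(e, s)", symmetric])
  qed (use sm[of "(1, 0)"] sm[of "(0, 1)"] in \<open>simp_all add: case_prod_unfold\<close>)
qed

lemma smooth_fun_continuous:
  assumes "smooth_fun (\<lambda>(e, s). G e s)"
  shows "continuous_on A (\<lambda>(e, s). G e s)"
proof -
  from assms obtain D where "\<And>x. ((\<lambda>(e, s). G e s) has_derivative D x) (at x)"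
    by (cases rule: smooth_fun.cases) auto
  then show ?thesis
    by (auto intro!: continuous_at_imp_continuous_on intro: has_derivative_continuous)
qed

text \<open>The end points of the chords depend on e through both arguments of \<open>G\<close>, so
  their velocities need the chain rule along a moving parameter.\<close>

lemma has_vector_derivative_curve:
  fixes G :: "real \<Rightarrow> real \<Rightarrow> 'b::real_normed_vector"
  assumes G: "\<And>e s. ((\<lambda>(e, s). G e s) has_derivative (\<lambda>(a, b). a *\<^sub>R Ge e s + b *\<^sub>R Gs e s)) (at (e, s))"
    and p: "(p has_vector_derivative p') (at x)" and q: "(q has_vector_derivative q') (at x)"
  shows "((\<lambda>x. G (p x) (q x)) has_vector_derivative (p' *\<^sub>R Ge (p x) (q x) + q' *\<^sub>R Gs (p x) (q x))) (at x)"
proof -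
  have "((\<lambda>x. (p x, q x)) has_derivative (\<lambda>h. (h *\<^sub>R p', h *\<^sub>R q'))) (at x)"
    using p q unfolding has_vector_derivative_def by (rule has_derivative_Pair)
  from has_derivative_compose[OF this G]
  show ?thesis
    unfolding has_vector_derivative_def
    by (simp add: algebra_simps)
qed

lemma partial_derivatives:
  fixes G :: "real \<Rightarrow> real \<Rightarrow> 'b::real_normed_vector"
  assumes G: "\<And>e s. ((\<lambda>(e, s). G e s) has_derivative (\<lambda>(a, b). a *\<^sub>R Ge e s + b *\<^sub>R Gs e s)) (at (e, s))"
  shows "((\<lambda>e. G e s) has_vector_derivative Ge e s) (at e)"
    and "((\<lambda>s. G e s) has_vector_derivative Gs e s) (at s)"
  using has_vector_derivative_curve[OF G, where p="\<lambda>x. x" and p'=1 and q="\<lambda>_. s" and q'=0 and x=e]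
    has_vector_derivative_curve[OF G, where p="\<lambda>_. e" and p'=0 and q="\<lambda>x. x" and q'=1 and x=s]
  by simp_all

text \<open>Integrating \<open>Gs\<close> from the base point s - 1 recovers \<open>G\<close>;
  differentiating under that integral in e, and then in its upper limit, exchanges the two
  derivatives. The base point keeps s in the interior of the interval. The exchange is needed
  because smoothness supplies the e-derivative of \<open>Gs\<close>, whereas the variation field
  \<open>Ge\<close> has to be differentiated along the curve.\<close>

lemma mixed_partial_derivatives_commute:
  fixes G :: "real \<Rightarrow> real \<Rightarrow> 'b::banach"
  assumes Ge: "\<And>e s. ((\<lambda>e. G e s) has_vector_derivative Ge e s) (at e)"
    and Gs: "\<And>e s. ((\<lambda>s. G e s) has_vector_derivative Gs e s) (at s)"
    and Gse: "\<And>e s. ((\<lambda>e. Gs e s) has_vector_derivative Gse e s) (at e)"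
    and c1: "\<And>e. continuous_on UNIV (Gs e)"
    and c2: "continuous_on UNIV (\<lambda>(e, s). Gse e s)"
  shows "((\<lambda>s. Ge e s) has_vector_derivative Gse e s) (at s)"
proof -
  have eq: "Ge e t = Ge e (s - 1) + integral {s - 1..t} (Gse e)" if "t \<in> {s - 1..s + 1}" for t
  proof -
    have I: "G e t = G e (s - 1) + integral {s - 1..t} (Gs e)" for e
    proof -
      have "(Gs e has_integral G e t - G e (s - 1)) {s - 1..t}"
        using that by (intro fundamental_theorem_of_calculus)
          (auto intro: has_vector_derivative_at_within Gs)
      then show ?thesis by (simp add: integral_unique)
    qed
    have "((\<lambda>e. integral (cbox (s - 1) t) (Gs e)) has_vector_derivative
        integral (cbox (s - 1) t) (Gse e)) (at e within UNIV)"
      by (rule leibniz_rule_vector_derivative)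
        (simp_all add: Gse continuous_on_subset[OF c1] continuous_on_subset[OF c2] integrable_continuous_real)
    then have "((\<lambda>e. G e (s - 1) + integral {s - 1..t} (Gs e)) has_vector_derivative
        Ge e (s - 1) + integral {s - 1..t} (Gse e)) (at e)"
      by (intro derivative_intros Ge) simp
    then have "((\<lambda>e. G e t) has_vector_derivative
        Ge e (s - 1) + integral {s - 1..t} (Gse e)) (at e)"
      by (simp only: I[symmetric])
    with Ge show ?thesis by (rule vector_derivative_unique_at)
  qed
  have "continuous_on {s - 1..s + 1} (Gse e)"
    using continuous_on_compose2[OF c2, of _ "\<lambda>s. (e, s)"] by (simp add: continuous_on_Pair)
  then have "((\<lambda>t. integral {s - 1..t} (Gse e)) has_vector_derivative Gse e s) (at s within {s - 1..s + 1})"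
    by (rule integral_has_vector_derivative) simp
  from has_vector_derivative_add[OF has_vector_derivative_const this]
  have "((\<lambda>t. Ge e (s - 1) + integral {s - 1..t} (Gse e)) has_vector_derivative Gse e s) (at s within {s - 1..s + 1})"
    by (simp only: add_0)
  from has_vector_derivative_transform[OF _ eq this]
  have "((\<lambda>t. Ge e t) has_vector_derivative Gse e s) (at s within {s - 1..s + 1})"
    by simp
  then have "((\<lambda>t. Ge e t) has_vector_derivative Gse e s) (at s within {s - 1<..<s + 1})"
    by (rule has_vector_derivative_within_subset) auto
  then show ?thesis
    by (subst (asm) has_vector_derivative_within_open) simp_all
qed

section \<open>Fourier coefficients\<close>

text \<open>Not normalised, and with positive exponent: for real f this is 2 pi times the conjugate
  of the usual coefficient, which explains the signs in the rules for shifts and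
  derivatives.\<close>

definition fourier_coeff :: "(real \<Rightarrow> real) \<Rightarrow> int \<Rightarrow> complex" where
  "fourier_coeff f k = integral {0..2 * pi} (\<lambda>u. of_real (f u) * cis (of_int k * u))"

lemma fourier_coeff_has_integral:
  assumes "continuous_on UNIV f"
  shows "((\<lambda>u. of_real (f u) * cis (of_int k * u)) has_integral fourier_coeff f k) {0..2 * pi}"
proof -
  have "continuous_on {0..2 * pi} f" by (rule continuous_on_subset[OF assms]) simp
  then have "(\<lambda>u. of_real (f u) * cis (of_int k * u)) integrable_on {0..2 * pi}"
    by (intro integrable_continuous_real continuous_intros)
  then show ?thesis unfolding fourier_coeff_def by (rule integrable_integral)
qed

lemma fourier_coeff_lincomb:
  assumes "continuous_on UNIV f" "continuous_on UNIV g"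
  shows "fourier_coeff (\<lambda>u. a * f u + b * g u) k = of_real a * fourier_coeff f k + of_real b * fourier_coeff g k"
proof -
  have "((\<lambda>u. of_real a * (of_real (f u) * cis (of_int k * u)) + of_real b * (of_real (g u) * cis (of_int k * u)))
      has_integral of_real a * fourier_coeff f k + of_real b * fourier_coeff g k) {0..2 * pi}"
    by (intro has_integral_add has_integral_mult_right fourier_coeff_has_integral assms)
  then show ?thesis
    by (subst fourier_coeff_def, intro integral_unique) (simp add: algebra_simps)
qed

lemma fourier_coeff_cos_mult:
  assumes f: "continuous_on UNIV f"
  shows "fourier_coeff (\<lambda>u. f u * cos u) k = (fourier_coeff f (k + 1) + fourier_coeff f (k - 1)) / 2"
proof -
  have eq: "of_real (f u * cos u) * cis (of_int k * u) =
      (of_real (f u) * cis (of_int (k + 1) * u) + of_real (f u) * cis (of_int (k - 1) * u)) / 2" for u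
    by (simp add: complex_eq_iff cos_add sin_add cos_diff sin_diff ring_distribs)
  show ?thesis
    by (subst fourier_coeff_def, intro integral_unique, unfold eq)
      (intro has_integral_divide has_integral_add fourier_coeff_has_integral f)
qed

lemma fourier_coeff_sin_mult:
  assumes f: "continuous_on UNIV f"
  shows "fourier_coeff (\<lambda>u. f u * sin u) k = (fourier_coeff f (k + 1) - fourier_coeff f (k - 1)) / (2 * \<i>)"
proof -
  have eq: "of_real (f u * sin u) * cis (of_int k * u) =
      (of_real (f u) * cis (of_int (k + 1) * u) - of_real (f u) * cis (of_int (k - 1) * u)) / (2 * \<i>)" for u
    by (simp add: complex_eq_iff cos_add sin_add cos_diff sin_diff ring_distribs Re_divide Im_divide power2_eq_square)
  show ?thesis
    by (subst fourier_coeff_def, intro integral_unique, unfold eq)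
      (intro has_integral_divide has_integral_diff fourier_coeff_has_integral f)
qed

lemma has_vector_derivative_cis:
  "((\<lambda>u. cis (a * u)) has_vector_derivative \<i> * of_real a * cis (a * u)) (at u within S)"
proof -
  have "((\<lambda>z. exp (\<i> * (of_real a * z))) has_field_derivative \<i> * of_real a * exp (\<i> * (of_real a * of_real u)))
      (at (of_real u))"
    by (auto intro!: derivative_eq_intros)
  then show ?thesis
    unfolding cis_conv_exp of_real_mult by (rule has_vector_derivative_real_field)
qed

lemma fourier_coeff_one: "fourier_coeff (\<lambda>_. 1) k = (if k = 0 then of_real (2 * pi) else 0)"
proof (cases "k = 0")
  case True
  then show ?thesis by (simp add: fourier_coeff_def scaleR_conv_of_real)
next
  case False
  have "((\<lambda>u. cis (of_int k * u)) has_integral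
      cis (of_int k * (2 * pi)) / (\<i> * of_int k) - cis (of_int k * 0) / (\<i> * of_int k)) {0..2 * pi}"
  proof (intro fundamental_theorem_of_calculus)
    fix u
    have "((\<lambda>u. cis (of_int k * u) / (\<i> * of_int k)) has_vector_derivative
        \<i> * of_real (of_int k) * cis (of_int k * u) / (\<i> * of_int k)) (at u within {0..2 * pi})"
      by (intro has_vector_derivative_divide has_vector_derivative_cis)
    then show "((\<lambda>u. cis (of_int k * u) / (\<i> * of_int k)) has_vector_derivative
        cis (of_int k * u)) (at u within {0..2 * pi})"
      using False by simp
  qed simp
  moreover have "cis (of_int k * (2 * pi)) = 1"
    using cis_multiple_2pi[of "of_int k"] by (simp add: mult.commute)
  ultimately show ?thesis
    using False by (simp add: fourier_coeff_def integral_unique)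
qed

lemma fourier_coeff_uminus: "fourier_coeff f (- k) = cnj (fourier_coeff f k)"
  by (simp add: fourier_coeff_def integral_cnj cis_cnj)

lemma continuous_on_real_polynomial_function_cis:
  assumes "real_polynomial_function g"
  shows "continuous_on S (\<lambda>u. g (cis u))"
proof -
  have "continuous_on UNIV g"
    using assms continuous_on_polymonial_function by (auto simp: real_polynomial_function_eq)
  then show ?thesis
    by (rule continuous_on_compose2) (auto intro: continuous_intros)
qed

text \<open>The functions with vanishing Fourier coefficients are closed under multiplication with
  cosine and sine, so they are orthogonal to every polynomial in cosine and sine.\<close>

lemma fourier_coeff_mult_polynomial_eq_0:
  assumes "real_polynomial_function g" "continuous_on UNIV f" "\<And>k. fourier_coeff f k = 0"
  shows "fourier_coeff (\<lambda>u. f u * g (cis u)) k = 0"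
  using assms
proof (induction arbitrary: f k rule: real_polynomial_function.induct)
  case (linear l)
  have "l (cis u) = cos u * l 1 + sin u * l \<i>" for u
  proof -
    interpret bounded_linear l by fact
    have "cis u = cos u *\<^sub>R 1 + sin u *\<^sub>R \<i>" by (simp add: complex_eq_iff)
    then show ?thesis by (simp only: add scale real_scaleR_def)
  qed
  then have "(\<lambda>u. f u * l (cis u)) = (\<lambda>u. l 1 * (f u * cos u) + l \<i> * (f u * sin u))"
    by (simp add: fun_eq_iff algebra_simps)
  then show ?case
    by (simp add: fourier_coeff_lincomb fourier_coeff_cos_mult fourier_coeff_sin_mult linear continuous_intros)
next
  case (const c)
  have "fourier_coeff (\<lambda>u. c * f u + 0 * f u) k = 0"
    by (subst fourier_coeff_lincomb) (simp_all add: const)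
  then show ?case by (simp add: mult.commute[of _ c])
next
  case (add p q)
  have cont: "continuous_on UNIV (\<lambda>u. f u * r (cis u))" if "real_polynomial_function r" for r
    by (intro continuous_intros add.prems continuous_on_real_polynomial_function_cis that)
  have "fourier_coeff (\<lambda>u. 1 * (f u * p (cis u)) + 1 * (f u * q (cis u))) k = 0"
    by (subst fourier_coeff_lincomb) (simp_all add: cont add)
  then show ?case by (simp add: distrib_left)
next
  case (mult p q)
  have cont: "continuous_on UNIV (\<lambda>u. f u * p (cis u))"
    by (intro continuous_intros mult continuous_on_real_polynomial_function_cis)
  \<comment> \<open>The induction is general in f: the product of f with p has vanishing
    coefficients again and takes the place of f for the factor q.\<close>
  show ?case
    using mult.IH(2)[OF cont] mult.IH(1)[OF mult.prems] by (simp add: mult.assoc)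
qed

text \<open>If g is a polynomial in cosine and sine uniformly e-close to q, the integral of q^2
  equals that of q (q - g) and is at most e times the integral of |q|. So the square integral is
  zero, and q vanishes by continuity.\<close>

lemma fourier_coeff_eq_0_imp_eq_0:
  fixes q :: "real \<Rightarrow> real"
  assumes cont: "continuous_on UNIV q" and per: "q (2 * pi) = q 0"
    and zero: "\<And>k. fourier_coeff q k = 0" and u: "u \<in> {0..2 * pi}"
  shows "q u = 0"
proof -
  define f where "f z = q (Arg2pi z)" for z
  have cont': "continuous_on {0..2 * pi} q" by (rule continuous_on_subset[OF cont]) simp
  have f_cis: "f (cis u) = q u" if "u \<in> {0..2 * pi}" for u
  proof (cases "u = 2 * pi")
    case True
    then show ?thesis using Arg2pi_of_real[of 1] by (simp add: f_def per)
  next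
    case False
    then have "Arg2pi (cis u) = u" using that by (intro Arg2pi_unique[of 1]) (auto simp: cis_conv_exp)
    then show ?thesis by (simp add: f_def)
  qed
  have sph: "sphere 0 1 = cis ` {0..2 * pi}"
  proof
    show "sphere 0 1 \<subseteq> cis ` {0..2 * pi}"
    proof
      fix z :: complex assume "z \<in> sphere 0 1"
      then have "z = cis (Arg2pi z)" using complex_norm_eq_1_exp[of z] by (simp add: cis_conv_exp)
      then show "z \<in> cis ` {0..2 * pi}"
        using Arg2pi_ge_0[of z] Arg2pi_lt_2pi[of z] by (intro image_eqI) auto
    qed
  qed auto
  \<comment> \<open>\<open>Arg2pi\<close> jumps at 1, so composing continuous maps is not enough.
    The graph of f is the compact image of the interval under u -> (cis u, q u), which uses that q
    has equal end values, and a closed graph over a compact target gives continuity.\<close>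
  have "continuous_on (sphere 0 1) f"
  proof (rule continuous_from_closed_graph)
    show "compact (q ` {0..2 * pi})" by (intro compact_continuous_image cont') simp
    show "f \<in> sphere 0 1 \<rightarrow> q ` {0..2 * pi}" by (auto simp: sph f_cis)
    have "(\<lambda>z. (z, f z)) ` sphere 0 1 = (\<lambda>u. (cis u, q u)) ` {0..2 * pi}"
      by (auto simp: sph image_image f_cis)
    moreover have "compact ((\<lambda>u. (cis u, q u)) ` {0..2 * pi})"
      by (intro compact_continuous_image continuous_intros cont') simp
    ultimately show "closed ((\<lambda>z. (z, f z)) ` sphere 0 1)" by (simp add: compact_imp_closed)
  qed
  then have approx: "\<exists>g. real_polynomial_function g \<and> (\<forall>u\<in>{0..2 * pi}. \<bar>q u - g (cis u)\<bar> < e)" if "e > 0" for e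
  proof -
    from Stone_Weierstrass_real_polynomial_function[OF compact_sphere _ that] \<open>continuous_on (sphere 0 1) f\<close>
    obtain g where g: "real_polynomial_function g" "\<And>z. z \<in> sphere 0 1 \<Longrightarrow> \<bar>f z - g z\<bar> < e" by blast
    have "\<bar>q u - g (cis u)\<bar> < e" if "u \<in> {0..2 * pi}" for u
    proof -
      have "\<bar>f (cis u) - g (cis u)\<bar> < e" by (rule g(2)) simp
      then show ?thesis unfolding f_cis[OF that] .
    qed
    then show ?thesis by (intro exI[of _ g] conjI ballI g(1))
  qed
  define I where "I = integral {0..2 * pi} (\<lambda>u. \<bar>q u\<bar>)"
  define J where "J = integral {0..2 * pi} (\<lambda>u. q u * q u)"
  have le: "J \<le> e * I" if e: "e > 0" for e
  proof -
    from approx[OF e] obtain g where g: "real_polynomial_function g"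
      and g': "\<forall>u\<in>{0..2 * pi}. \<bar>q u - g (cis u)\<bar> < e"
      by (elim exE conjE)
    have contg: "continuous_on UNIV (\<lambda>u. q u * g (cis u))"
      by (intro continuous_intros cont continuous_on_real_polynomial_function_cis g)
    have 0: "fourier_coeff (\<lambda>u. q u * g (cis u)) 0 = 0"
      by (rule fourier_coeff_mult_polynomial_eq_0[OF g cont zero])
    from fourier_coeff_has_integral[OF contg, of 0]
    have "((\<lambda>u. complex_of_real (q u * g (cis u)) * cis (of_int 0 * u)) has_integral 0) {0..2 * pi}"
      unfolding 0 .
    from has_integral_linear[OF this bounded_linear_Re]
    have z: "((\<lambda>u. q u * g (cis u)) has_integral 0) {0..2 * pi}"
      by (simp add: o_def)
    have "(\<lambda>u. q u * q u) integrable_on {0..2 * pi}"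
      by (intro integrable_continuous_real continuous_intros cont')
    then have "((\<lambda>u. q u * q u) has_integral J) {0..2 * pi}"
      unfolding J_def by (rule integrable_integral)
    from has_integral_diff[OF this z]
    have 1: "((\<lambda>u. q u * q u - q u * g (cis u)) has_integral J) {0..2 * pi}" by simp
    have "(\<lambda>u. \<bar>q u\<bar>) integrable_on {0..2 * pi}"
      by (intro integrable_continuous_real continuous_intros cont')
    then have "((\<lambda>u. \<bar>q u\<bar>) has_integral I) {0..2 * pi}"
      unfolding I_def by (rule integrable_integral)
    then have 2: "((\<lambda>u. e * \<bar>q u\<bar>) has_integral e * I) {0..2 * pi}"
      by (rule has_integral_mult_right)
    show ?thesis
    proof (rule has_integral_le[OF 1 2])
      fix u assume u: "u \<in> {0..2 * pi}"
      have "q u * q u - q u * g (cis u) \<le> \<bar>q u\<bar> * \<bar>q u - g (cis u)\<bar>"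
        by (metis abs_ge_self abs_mult right_diff_distrib)
      also have "\<dots> \<le> \<bar>q u\<bar> * e" using g' u by (intro mult_left_mono) (auto intro: less_imp_le)
      finally show "q u * q u - q u * g (cis u) \<le> e * \<bar>q u\<bar>" by (simp add: mult.commute)
    qed
  qed
  have "J \<le> 0"
  proof (rule field_le_epsilon)
    fix e :: real assume e: "e > 0"
    have I: "I \<ge> 0" unfolding I_def
      by (intro integral_nonneg integrable_continuous_real continuous_intros cont') auto
    have "J \<le> e / (I + 1) * I" using I e by (intro le) auto
    also have "\<dots> \<le> e" using I e by (simp add: field_simps)
    finally show "J \<le> 0 + e" by simp
  qed
  moreover have "J \<ge> 0" unfolding J_def
    by (intro integral_nonneg integrable_continuous_real continuous_intros cont') auto
  ultimately have "J = 0" by simp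
  then have "q u * q u = 0"
    unfolding J_def using u
    by (subst (asm) integral_eq_0_iff) (auto intro!: continuous_intros cont')
  then show ?thesis by simp
qed

lemma integral_periodic_shift:
  fixes F :: "real \<Rightarrow> complex"
  assumes cont: "continuous_on UNIV F" and per: "\<And>u. F (u + 2 * pi) = F u"
  shows "integral {0..2 * pi} (\<lambda>u. F (u + \<tau>)) = integral {0..2 * pi} F"
proof -
  interpret periodic_fun_simple F "2 * pi" by unfold_locales (rule per)
  define n where "n = \<lfloor>\<tau> / (2 * pi)\<rfloor>"
  define \<sigma> where "\<sigma> = \<tau> - of_int n * (2 * pi)"
  have \<sigma>: "0 \<le> \<sigma>" "\<sigma> \<le> 2 * pi"
    using floor_divide_lower[of "2 * pi" \<tau>] floor_divide_upper[of "2 * pi" \<tau>]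
    by (simp_all add: \<sigma>_def n_def algebra_simps)
  have int: "F integrable_on {a..b}" for a b
    by (intro integrable_continuous_real continuous_on_subset[OF cont]) simp
  have "F (u + \<tau>) = F (u + \<sigma>)" for u
    using plus_of_int[of "u + \<sigma>" n] by (simp add: \<sigma>_def algebra_simps)
  then have "integral {0..2 * pi} (\<lambda>u. F (u + \<tau>)) = integral {0..2 * pi} (\<lambda>u. F (u + \<sigma>))" by simp
  also have "\<dots> = integral {\<sigma>..2 * pi + \<sigma>} F"
    using integral_shift_real_ivl[of \<sigma> \<sigma> "2 * pi + \<sigma>" F] by simp
  also have "\<dots> = integral {\<sigma>..2 * pi} F + integral {2 * pi..2 * pi + \<sigma>} F"
    using Henstock_Kurzweil_Integration.integral_combine[of \<sigma> "2 * pi" "2 * pi + \<sigma>" F] \<sigma> int by simp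
  also have "integral {2 * pi..2 * pi + \<sigma>} F = integral {0..\<sigma>} F"
    using integral_shift_real_ivl[of "2 * pi" "2 * pi" "2 * pi + \<sigma>" F] by (simp add: per)
  also have "integral {\<sigma>..2 * pi} F + integral {0..\<sigma>} F = integral {0..2 * pi} F"
    using Henstock_Kurzweil_Integration.integral_combine[OF \<sigma> int] by (simp add: add.commute)
  finally show ?thesis .
qed

lemma fourier_coeff_shift:
  assumes cont: "continuous_on UNIV f" and per: "\<And>u. f (u + 2 * pi) = f u"
  shows "fourier_coeff (\<lambda>u. f (u + \<tau>)) k = cis (- (of_int k * \<tau>)) * fourier_coeff f k"
proof -
  have "fourier_coeff (\<lambda>u. f (u + \<tau>)) k =
      integral {0..2 * pi} (\<lambda>u. cis (- (of_int k * \<tau>)) * (of_real (f (u + \<tau>)) * cis (of_int k * (u + \<tau>))))"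
    unfolding fourier_coeff_def
  proof (rule integral_cong)
    fix u
    have "cis (of_int k * u) = cis (- (of_int k * \<tau>)) * cis (of_int k * (u + \<tau>))"
      by (simp add: cis_mult algebra_simps)
    then show "of_real (f (u + \<tau>)) * cis (of_int k * u) =
        cis (- (of_int k * \<tau>)) * (of_real (f (u + \<tau>)) * cis (of_int k * (u + \<tau>)))"
      by simp
  qed
  also have "\<dots> = cis (- (of_int k * \<tau>)) * integral {0..2 * pi} (\<lambda>u. of_real (f (u + \<tau>)) * cis (of_int k * (u + \<tau>)))"
    by simp
  also have "integral {0..2 * pi} (\<lambda>u. of_real (f (u + \<tau>)) * cis (of_int k * (u + \<tau>))) = fourier_coeff f k"
    unfolding fourier_coeff_def
  proof (rule integral_periodic_shift)
    show "continuous_on UNIV (\<lambda>u. of_real (f u) * cis (of_int k * u))"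
      by (intro continuous_intros cont)
    fix u
    have "cis (of_int k * (u + 2 * pi)) = cis (of_int k * u) * cis (2 * pi * of_int k)"
      by (simp only: cis_mult) (simp add: algebra_simps)
    also have "\<dots> = cis (of_int k * u)" by (subst cis_multiple_2pi) simp_all
    finally show "of_real (f (u + 2 * pi)) * cis (of_int k * (u + 2 * pi)) = of_real (f u) * cis (of_int k * u)"
      by (simp add: per)
  qed
  finally show ?thesis .
qed

lemma fourier_coeff_deriv:
  assumes D: "\<And>u. (f has_real_derivative f' u) (at u)" and cont: "continuous_on UNIV f'"
    and per: "f (2 * pi) = f 0"
  shows "fourier_coeff f' k = - \<i> * of_int k * fourier_coeff f k"
proof -
  have contf: "continuous_on UNIV f"
    using D by (auto intro!: continuous_at_imp_continuous_on DERIV_isCont)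
  have "((\<lambda>u. of_real (f' u) * cis (of_int k * u) + \<i> * of_int k * (of_real (f u) * cis (of_int k * u))) has_integral
      of_real (f (2 * pi)) * cis (of_int k * (2 * pi)) - of_real (f 0) * cis (of_int k * 0)) {0..2 * pi}"
  proof (intro fundamental_theorem_of_calculus)
    fix u
    have "((\<lambda>u. complex_of_real (f u)) has_vector_derivative of_real (f' u)) (at u within {0..2 * pi})"
      using D[of u] by (intro has_vector_derivative_of_real)
        (auto simp: has_real_derivative_iff_has_vector_derivative intro: has_vector_derivative_at_within)
    from has_vector_derivative_mult[OF this has_vector_derivative_cis[of "of_int k"]]
    show "((\<lambda>u. of_real (f u) * cis (of_int k * u)) has_vector_derivative
        of_real (f' u) * cis (of_int k * u) + \<i> * of_int k * (of_real (f u) * cis (of_int k * u)))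
        (at u within {0..2 * pi})"
      by (simp add: algebra_simps)
  qed simp
  moreover have "cis (of_int k * (2 * pi)) = 1"
    using cis_multiple_2pi[of "of_int k"] by (simp add: mult.commute)
  ultimately have 0: "((\<lambda>u. of_real (f' u) * cis (of_int k * u) + \<i> * of_int k * (of_real (f u) * cis (of_int k * u)))
      has_integral 0) {0..2 * pi}" by (simp add: per)
  have "((\<lambda>u. of_real (f' u) * cis (of_int k * u) + \<i> * of_int k * (of_real (f u) * cis (of_int k * u)))
      has_integral fourier_coeff f' k + \<i> * of_int k * fourier_coeff f k) {0..2 * pi}"
    by (intro has_integral_add has_integral_mult_right fourier_coeff_has_integral cont contf)
  from has_integral_unique[OF this 0] show ?thesis by (simp add: eq_neg_iff_add_eq_0)
qed

text \<open>With z = cis (k \<gamma>), the shift by 2 \<gamma> multiplies coefficients by the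
  squared conjugate of z. Multiplying the transformed equation by z makes it symmetric and leaves
  the coefficient times k cos (k \<gamma>) - m sin (k \<gamma>), up to the factor 2 i.\<close>

lemma fourier_coeff_functional_equation:
  assumes D: "\<And>u. (p has_real_derivative p' u) (at u)" and cont: "continuous_on UNIV p'"
    and per: "\<And>u. p (u + 2 * pi) = p u"
    and eq: "\<And>u. p' u + p' (u + 2 * \<gamma>) = m * (p (u + 2 * \<gamma>) - p u)"
    and k: "of_int k * cos (of_int k * \<gamma>) \<noteq> m * sin (of_int k * \<gamma>)"
  shows "fourier_coeff p k = 0"
proof -
  define z where "z = cis (of_int k * \<gamma>)"
  define c where "c = fourier_coeff p k"
  have per': "p' (u + 2 * pi) = p' u" for u
  proof -
    have "((\<lambda>u. p (u + 2 * pi)) has_real_derivative p' (u + 2 * pi)) (at u)"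
      using D[of "u + 2 * pi"] by (simp add: DERIV_shift)
    then show ?thesis using D DERIV_unique by (simp add: per) blast
  qed
  have contp: "continuous_on UNIV p"
    using D by (auto intro!: continuous_at_imp_continuous_on DERIV_isCont)
  have cs: "continuous_on UNIV (\<lambda>u. f (u + 2 * \<gamma>))" if "continuous_on UNIV f" for f :: "real \<Rightarrow> real"
    by (intro continuous_on_compose2[OF that] continuous_intros) simp
  have w: "cis (- (of_int k * (2 * \<gamma>))) = cnj z * cnj z"
    by (simp add: z_def cis_cnj cis_mult algebra_simps)
  have s: "fourier_coeff (\<lambda>u. p' (u + 2 * \<gamma>)) k = cnj z * cnj z * fourier_coeff p' k"
    "fourier_coeff (\<lambda>u. p (u + 2 * \<gamma>)) k = cnj z * cnj z * fourier_coeff p k"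
    unfolding w[symmetric] by (rule fourier_coeff_shift[OF cont per'], rule fourier_coeff_shift[OF contp per])
  have d: "fourier_coeff p' k = - \<i> * of_int k * fourier_coeff p k"
    using per[of 0] by (intro fourier_coeff_deriv D cont) simp
  have "fourier_coeff (\<lambda>u. 1 * p' u + 1 * p' (u + 2 * \<gamma>)) k = - \<i> * of_int k * c * (1 + cnj z * cnj z)"
    unfolding fourier_coeff_lincomb[OF cont cs[OF cont]] s d c_def by (simp add: algebra_simps)
  moreover have "fourier_coeff (\<lambda>u. m * p (u + 2 * \<gamma>) + (- m) * p u) k = m * c * (cnj z * cnj z - 1)"
    unfolding fourier_coeff_lincomb[OF cs[OF contp] contp] s c_def by (simp add: algebra_simps)
  moreover have "(\<lambda>u. 1 * p' u + 1 * p' (u + 2 * \<gamma>)) = (\<lambda>u. m * p (u + 2 * \<gamma>) + (- m) * p u)"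
    using eq by (simp add: fun_eq_iff right_diff_distrib)
  ultimately have "- \<i> * of_int k * c * (1 + cnj z * cnj z) = m * c * (cnj z * cnj z - 1)"
    by simp
  then have "z * (- \<i> * of_int k * c * (1 + cnj z * cnj z)) = z * (m * c * (cnj z * cnj z - 1))"
    by (rule arg_cong)
  moreover have "z * cnj z = 1" by (simp add: z_def cis_cnj cis_mult)
  ultimately have "- \<i> * of_int k * c * (z + cnj z) = m * c * (cnj z - z)" by algebra
  also have "z + cnj z = 2 * of_real (cos (of_int k * \<gamma>))" by (simp add: z_def complex_eq_iff)
  also have "cnj z - z = - 2 * \<i> * of_real (sin (of_int k * \<gamma>))" by (simp add: z_def complex_eq_iff)
  finally have "2 * \<i> * c * of_real (of_int k * cos (of_int k * \<gamma>) - m * sin (of_int k * \<gamma>)) = 0"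
    by (simp add: algebra_simps)
  moreover have "of_int k * cos (of_int k * \<gamma>) - m * sin (of_int k * \<gamma>) \<noteq> 0" using k by simp
  ultimately show ?thesis
    unfolding c_def by (metis complex_i_not_zero mult_eq_0_iff of_real_eq_0_iff zero_neq_numeral)
qed

text \<open>Orders 0 and 1 have to stay free: for k = 0 both sides of the resonance condition
  vanish, and for k = 1 it is the equation defining \<gamma> in the application. Geometrically they
  are the change of radius and the displacement of the circle. Matching these coefficients leaves a
  remainder q with no nonzero coefficient.\<close>

lemma functional_equation_imp_trigonometric:
  fixes p :: "real \<Rightarrow> real"
  assumes D: "\<And>u. (p has_real_derivative p' u) (at u)" and cont: "continuous_on UNIV p'"
    and per: "\<And>u. p (u + 2 * pi) = p u"
    and eq: "\<And>u. p' u + p' (u + 2 * \<gamma>) = m * (p (u + 2 * \<gamma>) - p u)"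
    and no: "\<And>k::nat. k \<ge> 2 \<Longrightarrow> real k * cos (real k * \<gamma>) \<noteq> m * sin (real k * \<gamma>)"
  obtains a b d where "\<And>u. p u = a + b * cos u + d * sin u"
proof -
  have contp: "continuous_on UNIV p"
    using D by (auto intro!: continuous_at_imp_continuous_on DERIV_isCont)
  have high: "fourier_coeff p k = 0" if k: "\<bar>k\<bar> \<ge> 2" for k :: int
  proof (rule fourier_coeff_functional_equation[OF D cont per eq])
    define j where "j = nat \<bar>k\<bar>"
    have "real j * cos (real j * \<gamma>) \<noteq> m * sin (real j * \<gamma>)" using k by (intro no) (simp add: j_def)
    moreover have "of_int k = real j \<or> of_int k = - real j" by (auto simp: j_def)
    ultimately show "of_int k * cos (of_int k * \<gamma>) \<noteq> m * sin (of_int k * \<gamma>)" by auto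
  qed
  have one: "continuous_on UNIV (\<lambda>u. 1 :: real)" by (rule continuous_on_const)
  have cos: "fourier_coeff cos k = (fourier_coeff (\<lambda>_. 1) (k + 1) + fourier_coeff (\<lambda>_. 1) (k - 1)) / 2" for k
    using fourier_coeff_cos_mult[OF one, of k] by simp
  have sin: "fourier_coeff sin k = (fourier_coeff (\<lambda>_. 1) (k + 1) - fourier_coeff (\<lambda>_. 1) (k - 1)) / (2 * \<i>)" for k
    using fourier_coeff_sin_mult[OF one, of k] by simp
  \<comment> \<open>At order 0 the constant 1 has coefficient 2 pi; at order 1 cosine has pi and
    sine has i pi. So the coefficient of p at order 1 must be pi (b + i d).\<close>
  define a where "a = Re (fourier_coeff p 0) / (2 * pi)"
  define b where "b = Re (fourier_coeff p 1) / pi"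
  define d where "d = Im (fourier_coeff p 1) / pi"
  define q where "q u = 1 * p u + (-1) * (a * 1 + 1 * (b * cos u + d * sin u))" for u
  have c1: "continuous_on UNIV (\<lambda>u. b * cos u + d * sin u)"
    and c2: "continuous_on UNIV (\<lambda>u. a * 1 + 1 * (b * cos u + d * sin u))"
    by (intro continuous_intros)+
  have q: "fourier_coeff q k = fourier_coeff p k
      - (a * fourier_coeff (\<lambda>_. 1) k + (b * fourier_coeff cos k + d * fourier_coeff sin k))" for k
  proof -
    have "fourier_coeff q k = of_real 1 * fourier_coeff p k + of_real (-1) * fourier_coeff (\<lambda>u. a * 1 + 1 * (b * cos u + d * sin u)) k"
      unfolding q_def by (rule fourier_coeff_lincomb[OF contp c2])
    also have "fourier_coeff (\<lambda>u. a * 1 + 1 * (b * cos u + d * sin u)) k =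
        of_real a * fourier_coeff (\<lambda>_. 1) k + of_real 1 * fourier_coeff (\<lambda>u. b * cos u + d * sin u) k"
      by (rule fourier_coeff_lincomb[OF one c1])
    also have "fourier_coeff (\<lambda>u. b * cos u + d * sin u) k = of_real b * fourier_coeff cos k + of_real d * fourier_coeff sin k"
      by (rule fourier_coeff_lincomb) (intro continuous_intros)+
    finally show ?thesis by simp
  qed
  have real0: "Im (fourier_coeff p 0) = 0" using fourier_coeff_uminus[of p 0] by (simp add: complex_eq_iff)
  have zero: "fourier_coeff q k = 0" for k
  proof -
    consider "\<bar>k\<bar> \<ge> 2" | "k = 0" | "k = 1" | "k = -1" by linarith
    then show ?thesis
    proof cases
      case 1
      then have "k \<noteq> 0" "k + 1 \<noteq> 0" "k - 1 \<noteq> 0" by auto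
      then show ?thesis using high[OF 1] by (simp add: q cos sin fourier_coeff_one)
    next
      case 2
      then show ?thesis
        using real0 by (simp add: q cos sin fourier_coeff_one a_def complex_eq_iff)
    next
      case 3
      then show ?thesis
        by (simp add: q cos sin fourier_coeff_one b_def d_def complex_eq_iff)
    next
      case 4
      then show ?thesis using fourier_coeff_uminus[of p 1]
        by (simp add: q cos sin fourier_coeff_one b_def d_def complex_eq_iff)
    qed
  qed
  have contq: "continuous_on UNIV q" unfolding q_def by (intro continuous_intros contp)
  interpret q: periodic_fun_simple q "2 * pi" by unfold_locales (simp add: q_def per)
  have "q u = 0" for u
  proof -
    define n where "n = \<lfloor>u / (2 * pi)\<rfloor>"
    define v where "v = u - of_int n * (2 * pi)"
    have v: "v \<in> {0..2 * pi}"
      using floor_divide_lower[of "2 * pi" u] floor_divide_upper[of "2 * pi" u]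
      by (simp add: v_def n_def algebra_simps)
    have "q u = q v" using q.plus_of_int[of v n] by (simp add: v_def)
    also have "\<dots> = 0"
      using fourier_coeff_eq_0_imp_eq_0[OF contq _ zero v] q.plus_1[of 0] by simp
    finally show ?thesis .
  qed
  then have "p u = a + b * cos u + d * sin u" for u using q_def[of u] by (simp add: algebra_simps)
  then show ?thesis by (rule that)
qed

section \<open>Angle functions\<close>

lemma continuous_antiderivative:
  fixes f :: "real \<Rightarrow> real"
  assumes "continuous_on UNIV f"
  obtains F where "\<And>x. (F has_real_derivative f x) (at x)"
proof
  fix x :: real
  define b where "b = \<bar>x\<bar> + 1"
  have "continuous_on {- b..b} f" by (rule continuous_on_subset[OF assms]) simp
  then have "((\<lambda>u. LBINT y=0..u. f y) has_vector_derivative f x) (at x within {- b..b})"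
    using interval_integral_FTC2[of "-b" 0 b f x] by (simp add: b_def zero_ereal_def)
  then have "((\<lambda>u. LBINT y=0..u. f y) has_vector_derivative f x) (at x within {- b<..<b})"
    by (rule has_vector_derivative_within_subset) auto
  then show "((\<lambda>u. LBINT y=0..u. f y) has_real_derivative f x) (at x)"
    unfolding has_real_derivative_iff_has_vector_derivative
    by (subst (asm) has_vector_derivative_within_open) (auto simp: b_def)
qed

text \<open>The candidate is an antiderivative of a b' - b a' with the right value at 0. Since (a',
  b') is orthogonal to the unit vector (a, b), the inner product of (a, b) with (cos \<theta>, sin
  \<theta>) has derivative zero. It is 1 at 0, and unit vectors with inner product 1
  coincide.\<close>

lemma angle_lift:
  fixes a b :: "real \<Rightarrow> real"
  assumes a: "\<And>s. (a has_real_derivative a' s) (at s)" and b: "\<And>s. (b has_real_derivative b' s) (at s)"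
    and cont: "continuous_on UNIV a'" "continuous_on UNIV b'"
    and circ: "\<And>s. (a s)\<^sup>2 + (b s)\<^sup>2 = 1"
  obtains \<theta> where "\<And>s. (\<theta> has_real_derivative a s * b' s - b s * a' s) (at s)"
    "\<And>s. a s = cos (\<theta> s)" "\<And>s. b s = sin (\<theta> s)"
proof -
  have ca: "continuous_on UNIV a" and cb: "continuous_on UNIV b"
    using a b by (auto intro!: continuous_at_imp_continuous_on DERIV_isCont)
  have "continuous_on UNIV (\<lambda>s. a s * b' s - b s * a' s)" by (intro continuous_intros ca cb cont)
  from continuous_antiderivative[OF this] obtain F where F: "\<And>s. (F has_real_derivative a s * b' s - b s * a' s) (at s)"
    by blast
  obtain t where t: "a 0 = cos t" "b 0 = sin t" using sincos_total_2pi[OF circ[of 0]] by metis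
  define \<theta> where "\<theta> s = F s - F 0 + t" for s
  have \<theta>: "(\<theta> has_real_derivative a s * b' s - b s * a' s) (at s)" for s
    unfolding \<theta>_def by (auto intro!: derivative_eq_intros F)
  have orth: "a s * a' s + b s * b' s = 0" for s
  proof -
    have "((\<lambda>s. (a s)\<^sup>2 + (b s)\<^sup>2) has_real_derivative 2 * (a s * a' s + b s * b' s)) (at s)"
      by (auto intro!: derivative_eq_intros a b simp: algebra_simps)
    then have "((\<lambda>s. 1) has_real_derivative 2 * (a s * a' s + b s * b' s)) (at s)"
      by (simp only: circ)
    from DERIV_unique[OF this DERIV_const] show ?thesis by simp
  qed
  have "a s * cos (\<theta> s) + b s * sin (\<theta> s) = a 0 * cos (\<theta> 0) + b 0 * sin (\<theta> 0)" for s
  proof (rule DERIV_isconst_all[where f = "\<lambda>s. a s * cos (\<theta> s) + b s * sin (\<theta> s)"])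
    show "\<forall>s. ((\<lambda>s. a s * cos (\<theta> s) + b s * sin (\<theta> s)) has_real_derivative 0) (at s)"
    proof
      fix s
      define w where "w = a s * b' s - b s * a' s"
      have "((\<lambda>s. a s * cos (\<theta> s) + b s * sin (\<theta> s)) has_real_derivative
          a' s * cos (\<theta> s) - (a s * w) * sin (\<theta> s) + b' s * sin (\<theta> s) + (b s * w) * cos (\<theta> s)) (at s)"
        unfolding w_def by (rule derivative_eq_intros a b \<theta> refl | simp add: algebra_simps)+
      moreover have "a s * w = b' s" "b s * w = - a' s"
        unfolding w_def using circ[of s] orth[of s] by algebra+
      ultimately show "((\<lambda>s. a s * cos (\<theta> s) + b s * sin (\<theta> s)) has_real_derivative 0) (at s)" by simp
    qed
  qed
  also have "a 0 * cos (\<theta> 0) + b 0 * sin (\<theta> 0) = 1"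
    by (simp add: \<theta>_def t flip: power2_eq_square)
  finally have one: "a s * cos (\<theta> s) + b s * sin (\<theta> s) = 1" for s .
  have "(a s - cos (\<theta> s))\<^sup>2 + (b s - sin (\<theta> s))\<^sup>2 = 0" for s
    using one[of s] circ[of s] sin_cos_squared_add[of "\<theta> s"] by algebra
  then have "a s = cos (\<theta> s)" "b s = sin (\<theta> s)" for s
    by (simp_all add: sum_power2_eq_zero_iff)
  with \<theta> show ?thesis by (rule that)
qed

text \<open>Needed twice: to invert the angle function, and for \<open>\<phi> 0\<close>, so that
  every point of the circle is the start of a chord.\<close>

lemma quasi_periodic_surj:
  fixes f :: "real \<Rightarrow> real"
  assumes cont: "continuous_on UNIV f" and per: "\<And>t. f (t + 2 * pi) = f t + 2 * pi"
  shows "\<exists>t. f t = u"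
proof -
  interpret periodic_fun_simple "\<lambda>t. f t - t" "2 * pi"
    by unfold_locales (simp add: per)
  have shift: "f (of_int n * (2 * pi)) = f 0 + of_int n * (2 * pi)" for n
    using plus_of_int[of 0 n] by simp
  define n where "n = \<lfloor>(u - f 0) / (2 * pi)\<rfloor>"
  have "f (of_int n * (2 * pi)) \<le> u" "u \<le> f (of_int (n + 1) * (2 * pi))"
    unfolding shift
    using floor_divide_lower[of "2 * pi" "u - f 0"] floor_divide_upper[of "2 * pi" "u - f 0"]
    by (simp_all add: n_def algebra_simps)
  then show ?thesis
    using IVT'[of f "of_int n * (2 * pi)" u "of_int (n + 1) * (2 * pi)"]
      continuous_on_subset[OF cont] by (auto simp: algebra_simps)
qed

lemma quasi_periodic_inverse:
  fixes \<theta> :: "real \<Rightarrow> real"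
  assumes D: "\<And>s. (\<theta> has_real_derivative \<omega> s) (at s)" and pos: "\<And>s. \<omega> s > 0"
    and per: "\<And>s. \<theta> (s + 2 * pi) = \<theta> s + 2 * pi"
  obtains J where "\<And>s. J (\<theta> s) = s" "\<And>u. \<theta> (J u) = u"
    "\<And>u. (J has_real_derivative 1 / \<omega> (J u)) (at u)" "\<And>u. J (u + 2 * pi) = J u + 2 * pi"
proof -
  have cont: "continuous_on UNIV \<theta>" and iscont: "\<And>s. isCont \<theta> s"
    using D by (auto intro!: continuous_at_imp_continuous_on DERIV_isCont)
  have "strict_mono \<theta>"
    using DERIV_pos_imp_increasing[of _ _ \<theta>] D pos by (intro strict_monoI) blast
  then have inj: "inj \<theta>" by (rule strict_mono_imp_inj_on)
  define J where "J = inv \<theta>"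
  have J1: "J (\<theta> s) = s" for s using inj by (simp add: J_def)
  have J2: "\<theta> (J u) = u" for u
    using quasi_periodic_surj[OF cont per, of u] unfolding J_def by (intro f_inv_into_f) auto
  have contJ: "isCont J u" for u
    using isCont_inverse_function[of 1 "J u" J \<theta>] J1 iscont J2 by simp
  show ?thesis
  proof (rule that[of J])
    show "(J has_real_derivative 1 / \<omega> (J u)) (at u)" for u
      using DERIV_inverse_function[of \<theta> "\<omega> (J u)" J u "u - 1" "u + 1"] D[of "J u"] pos[of "J u"] J2 contJ
      by (simp add: inverse_eq_divide)
    show "J (u + 2 * pi) = J u + 2 * pi" for u
      by (metis J1 J2 per)
  qed (rule J1, rule J2)
qed

section \<open>Orthonormal frames in the ambient space\<close>

lemma sg_square [simp]: "sg g * sg g = 1"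
  by (cases g) (simp_all add: sg_def)

lemma model_ip: "p \<in> model g \<Longrightarrow> ip g p p = sg g"
  by (cases g) (auto simp: model_def sg_def)

lemma ip_commute: "ip g u v = ip g v u"
  by (simp add: ip_def mult.commute)

lemma bounded_bilinear_ip: "bounded_bilinear (ip g)"
  unfolding bilinear_conv_bounded_bilinear[symmetric] bilinear_def
  by (auto intro!: linearI simp: ip_def algebra_simps)

lemma ip_add_left: "ip g (u + v) w = ip g u w + ip g v w"
  and ip_add_right: "ip g w (u + v) = ip g w u + ip g w v"
  and ip_diff_left: "ip g (u - v) w = ip g u w - ip g v w"
  and ip_diff_right: "ip g w (u - v) = ip g w u - ip g w v"
  and ip_scaleR_left: "ip g (a *\<^sub>R u) w = a * ip g u w"
  and ip_scaleR_right: "ip g w (a *\<^sub>R u) = a * ip g w u"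
  and ip_minus_left: "ip g (- u) w = - ip g u w"
  and ip_minus_right: "ip g w (- u) = - ip g w u"
  by (simp_all add: ip_def algebra_simps)

lemmas ip_simps = ip_add_left ip_add_right ip_diff_left ip_diff_right ip_scaleR_left ip_scaleR_right
  ip_minus_left ip_minus_right

lemma has_real_derivative_ip:
  assumes "(f has_vector_derivative f') (at x)" "(h has_vector_derivative h') (at x)"
  shows "((\<lambda>x. ip g (f x) (h x)) has_real_derivative ip g (f x) h' + ip g f' (h x)) (at x)"
  unfolding has_real_derivative_iff_has_vector_derivative
  by (rule bounded_bilinear.has_vector_derivative[OF bounded_bilinear_ip assms])

text \<open>The basis for polar coordinates around c. Spanning is recorded as the expansion formula,
  which makes the coordinates inner products. The orientation is left open, so that it can be fitted
  to the direction of the curve.\<close>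

locale adapted_frame =
  fixes g :: geom and e1 e2 c :: "real^3"
  assumes ip_frame: "ip g e1 e1 = 1" "ip g e2 e2 = 1" "ip g c c = sg g"
      "ip g e1 e2 = 0" "ip g e1 c = 0" "ip g e2 c = 0"
    and frame_spans: "v = ip g v e1 *\<^sub>R e1 + ip g v e2 *\<^sub>R e2 + (sg g * ip g v c) *\<^sub>R c"
begin

definition fr :: "real \<Rightarrow> real \<Rightarrow> real \<Rightarrow> real^3" where
  "fr a b z = a *\<^sub>R e1 + b *\<^sub>R e2 + z *\<^sub>R c"

lemma ip_frame_commuted: "ip g e2 e1 = 0" "ip g c e1 = 0" "ip g c e2 = 0"
  using ip_frame(4-6) by (simp_all only: ip_commute[of g e2 e1] ip_commute[of g c e1] ip_commute[of g c e2])

lemma ip_fr: "ip g (fr a b z) (fr a' b' z') = a * a' + b * b' + sg g * (z * z')"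
  by (simp add: fr_def ip_simps ip_frame ip_frame_commuted algebra_simps)

lemma fr_ip: "fr (ip g v e1) (ip g v e2) (sg g * ip g v c) = v"
  unfolding fr_def by (rule frame_spans[symmetric])

lemma ip_fr_frame: "ip g (fr a b z) e1 = a" "ip g (fr a b z) e2 = b" "ip g (fr a b z) c = sg g * z"
  by (simp_all add: fr_def ip_simps ip_frame ip_frame_commuted)

lemma fr_eq_iff: "fr a b z = fr a' b' z' \<longleftrightarrow> a = a' \<and> b = b' \<and> z = z'"
proof
  assume "fr a b z = fr a' b' z'"
  then have "a = a'" "b = b'" "sg g * z = sg g * z'" by (metis ip_fr_frame)+
  then show "a = a' \<and> b = b' \<and> z = z'" using sg_square[of g] by (metis mult_cancel_left mult_zero_left zero_neq_one)
qed simp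

lemma fr_arith:
  "fr a b z + fr a' b' z' = fr (a + a') (b + b') (z + z')"
  "fr a b z - fr a' b' z' = fr (a - a') (b - b') (z - z')"
  "k *\<^sub>R fr a b z = fr (k * a) (k * b) (k * z)"
  by (simp_all add: fr_def algebra_simps)

lemma has_vector_derivative_fr:
  assumes "(a has_real_derivative a') (at x)" "(b has_real_derivative b') (at x)"
    "(z has_real_derivative z') (at x)"
  shows "((\<lambda>x. fr (a x) (b x) (z x)) has_vector_derivative fr a' b' z') (at x)"
  unfolding fr_def
  by (auto intro!: derivative_eq_intros assms)

lemma det3_fr:
  "det3 (fr a b z) (fr a' b' z') (fr a'' b'' z'') =
    (a * (b' * z'' - z' * b'') - b * (a' * z'' - z' * a'') + z * (a' * b'' - b' * a'')) * det3 e1 e2 c"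
  unfolding det3_def fr_def by (simp, algebra)

lemma reflected_frame: "adapted_frame g e1 (- e2) c"
proof
  show "v = ip g v e1 *\<^sub>R e1 + ip g v (- e2) *\<^sub>R - e2 + (sg g * ip g v c) *\<^sub>R c" for v
    unfolding ip_minus_right scaleR_minus_left scaleR_minus_right minus_minus by (rule frame_spans)
qed (simp_all add: ip_simps ip_frame)

end

lemma adapted_frame_exists:
  assumes c: "c \<in> model g"
  obtains e1 e2 where "adapted_frame g e1 e2 c"
\<comment> \<open>At -1 the factor \<open>1 / (1 + c $ 3)\<close> of the general construction breaks
  down. This happens only at the south pole of the sphere, where the first two standard basis
  vectors serve.\<close>
proof (cases "c $ 3 = - 1")
  case True
  with c have g: "g = Sphere" by (cases g) (simp_all add: model_def)
  with True model_ip[OF c] have "(c $ 1)\<^sup>2 + (c $ 2)\<^sup>2 = 0"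
    by (simp add: ip_def sg_def power2_eq_square)
  then have c': "c $ 1 = 0" "c $ 2 = 0" by (simp_all add: sum_power2_eq_zero_iff)
  show ?thesis
  proof (rule that[of "vector [1, 0, 0]" "vector [0, 1, 0]"], unfold_locales)
    let ?e1 = "vector [1, 0, 0] :: real^3" and ?e2 = "vector [0, 1, 0] :: real^3"
    show "ip g ?e1 ?e1 = 1" "ip g ?e2 ?e2 = 1" "ip g ?e1 ?e2 = 0" "ip g ?e1 c = 0" "ip g ?e2 c = 0"
      "ip g c c = sg g"
      using True c' g by (simp_all add: ip_def sg_def vector_3)
    show "v = ip g v ?e1 *\<^sub>R ?e1 + ip g v ?e2 *\<^sub>R ?e2 + (sg g * ip g v c) *\<^sub>R c" for v
      unfolding vec_eq_iff forall_3 ip_def vector_add_component vector_scaleR_component vector_3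
        real_scaleR_def
      using True c' g by (simp add: sg_def)
  qed
next
  case False
  define q k where "q = sg g" and "k = 1 / (1 + c $ 3)"
  have q: "q * q = 1" by (simp add: q_def)
  have k: "k * (1 + c $ 3) = 1" using False by (simp add: k_def)
  have n: "c $ 1 * c $ 1 + c $ 2 * c $ 2 + q * (c $ 3 * c $ 3) = q"
    using model_ip[OF c] by (simp add: ip_def q_def)
  \<comment> \<open>the images of the first two standard basis vectors under the reflection exchanging
    \<open>c\<close> with the negative of the third one\<close>
  let ?e1 = "vector [1 - q * k * c $ 1 * c $ 1, - q * k * c $ 1 * c $ 2, - q * c $ 1] :: real^3"
  let ?e2 = "vector [- q * k * c $ 1 * c $ 2, 1 - q * k * c $ 2 * c $ 2, - q * c $ 2] :: real^3"
  show ?thesis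
  proof (rule that[of ?e1 ?e2], unfold_locales)
    show "ip g ?e1 ?e1 = 1" "ip g ?e2 ?e2 = 1" "ip g ?e1 ?e2 = 0" "ip g ?e1 c = 0" "ip g ?e2 c = 0"
      unfolding ip_def vector_3 q_def[symmetric] using q k n by algebra+
    show "ip g c c = sg g" by (rule model_ip[OF c])
    show "v = ip g v ?e1 *\<^sub>R ?e1 + ip g v ?e2 *\<^sub>R ?e2 + (sg g * ip g v c) *\<^sub>R c" for v
      unfolding vec_eq_iff forall_3 ip_def vector_add_component vector_scaleR_component vector_3 q_def[symmetric]
        real_scaleR_def
    proof (intro conjI)
    qed (use q k n in algebra)+
  qed
qed

section \<open>Circles in polar coordinates: direction and winding number\<close>

lemma continuous_nonzero_sign:
  fixes f :: "real \<Rightarrow> real"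
  assumes "continuous_on UNIV f" "\<And>x. f x \<noteq> 0"
  shows "(\<forall>x. f x > 0) \<or> (\<forall>x. f x < 0)"
proof (rule ccontr)
  assume "\<not> ?thesis"
  then obtain x y where "f x \<le> 0" "f y \<ge> 0" by (auto simp: not_less)
  moreover have "connected (range f)" by (rule connected_continuous_image[OF assms(1) connected_UNIV])
  ultimately have "0 \<in> range f" using connectedD_interval[of "range f" "f x" "f y" 0] by simp
  then show False using assms(2) by (metis imageE)
qed

text \<open>The coordinates divided by r run on the unit circle and have an angle function. Its
  derivative is nonzero because the curve is regular, and by continuity it keeps its sign, which
  depends on the direction of the curve.\<close>

lemma (in adapted_frame) circle_angle_function:
  fixes \<gamma> :: "real \<Rightarrow> real^3"
  assumes r: "r > 0" "r\<^sup>2 + sg g * h\<^sup>2 = sg g"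
    and \<gamma>: "\<And>s. (\<gamma> has_vector_derivative \<gamma>' s) (at s)" and cont: "continuous_on UNIV \<gamma>'"
    and model: "\<And>s. ip g (\<gamma> s) (\<gamma> s) = sg g" and height: "\<And>s. ip g (\<gamma> s) c = sg g * h"
    and reg: "\<And>s. ip g (\<gamma>' s) (\<gamma>' s) > 0"
  obtains \<theta> \<omega> where "\<And>s. \<gamma> s = fr (r * cos (\<theta> s)) (r * sin (\<theta> s)) h"
    "\<And>s. (\<theta> has_real_derivative \<omega> s) (at s)" "(\<forall>s. \<omega> s > 0) \<or> (\<forall>s. \<omega> s < 0)"
proof -
  define a where "a s = ip g (\<gamma> s) e1 / r" for s
  define b where "b s = ip g (\<gamma> s) e2 / r" for s
  define a' where "a' s = ip g (\<gamma>' s) e1 / r" for s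
  define b' where "b' s = ip g (\<gamma>' s) e2 / r" for s
  have a: "(a has_real_derivative a' s) (at s)" and b: "(b has_real_derivative b' s) (at s)" for s
    using DERIV_cdivide[OF has_real_derivative_ip[OF \<gamma>[of s] has_vector_derivative_const], of g _ r]
    unfolding a_def[abs_def] b_def[abs_def] a'_def b'_def by (simp_all add: ip_def)
  have ca: "continuous_on UNIV a'" and cb: "continuous_on UNIV b'"
    unfolding a'_def[abs_def] b'_def[abs_def] ip_def using r by (auto intro!: continuous_intros cont)
  have \<gamma>_ab: "\<gamma> s = fr (r * a s) (r * b s) h" for s
    using fr_ip[of "\<gamma> s"] r by (simp add: a_def b_def height flip: mult.assoc)
  have circ: "(a s)\<^sup>2 + (b s)\<^sup>2 = 1" for s
  proof -
    have "r\<^sup>2 * ((a s)\<^sup>2 + (b s)\<^sup>2) + sg g * h\<^sup>2 = r\<^sup>2 * 1 + sg g * h\<^sup>2"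
      using model[of s] r(2) unfolding \<gamma>_ab[of s] ip_fr by (simp add: algebra_simps power2_eq_square)
    then show ?thesis using r(1) by (metis add_right_cancel mult_left_cancel power_not_zero less_numeral_extra(3))
  qed
  obtain \<theta> where \<theta>: "\<And>s. (\<theta> has_real_derivative a s * b' s - b s * a' s) (at s)"
    and ab: "\<And>s. a s = cos (\<theta> s)" "\<And>s. b s = sin (\<theta> s)"
    using angle_lift[OF a b ca cb circ] by blast
  define \<omega> where "\<omega> s = a s * b' s - b s * a' s" for s
  have c\<omega>: "continuous_on UNIV \<omega>"
  proof -
    have "continuous_on UNIV a" "continuous_on UNIV b"
      using a b by (auto intro!: continuous_at_imp_continuous_on DERIV_isCont)
    then show ?thesis unfolding \<omega>_def[abs_def] by (intro continuous_intros ca cb)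
  qed
  have \<gamma>_eq: "\<gamma> s = fr (r * cos (\<theta> s)) (r * sin (\<theta> s)) h" for s
    using \<gamma>_ab[of s] ab by simp
  have "\<omega> s \<noteq> 0" for s
  proof -
    have "((\<lambda>s. fr (r * cos (\<theta> s)) (r * sin (\<theta> s)) h) has_vector_derivative
        fr (- r * sin (\<theta> s) * \<omega> s) (r * cos (\<theta> s) * \<omega> s) 0) (at s)"
      unfolding \<omega>_def by (intro has_vector_derivative_fr) (auto intro!: derivative_eq_intros \<theta>)
    with \<gamma> have "\<gamma>' s = fr (- r * sin (\<theta> s) * \<omega> s) (r * cos (\<theta> s) * \<omega> s) 0"
      unfolding \<gamma>_eq[symmetric] by (intro vector_derivative_unique_at)
    with reg[of s] show ?thesis by (auto simp: ip_fr)
  qed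
  with c\<omega> have "(\<forall>s. \<omega> s > 0) \<or> (\<forall>s. \<omega> s < 0)" by (rule continuous_nonzero_sign)
  with \<gamma>_eq \<theta> show ?thesis unfolding \<omega>_def by (intro that)
qed

text \<open>If the angle decreases, reflecting e2 reverses it; hence the frame in the conclusion may
  differ from the given one.\<close>

lemma circle_angle_parametrization:
  fixes \<gamma> :: "real \<Rightarrow> real^3"
  assumes frame: "adapted_frame g e1 e2 c"
    and r: "r > 0" "r\<^sup>2 + sg g * h\<^sup>2 = sg g"
    and \<gamma>: "\<And>s. (\<gamma> has_vector_derivative \<gamma>' s) (at s)" and cont: "continuous_on UNIV \<gamma>'"
    and model: "\<And>s. ip g (\<gamma> s) (\<gamma> s) = sg g" and height: "\<And>s. ip g (\<gamma> s) c = sg g * h"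
    and reg: "\<And>s. ip g (\<gamma>' s) (\<gamma>' s) > 0"
  obtains e2' \<theta> \<omega> where "adapted_frame g e1 e2' c"
    "\<And>s. \<gamma> s = adapted_frame.fr e1 e2' c (r * cos (\<theta> s)) (r * sin (\<theta> s)) h"
    "\<And>s. (\<theta> has_real_derivative \<omega> s) (at s)" "\<And>s. \<omega> s > 0"
proof -
  interpret adapted_frame g e1 e2 c by fact
  obtain \<theta> \<omega> where *: "\<And>s. \<gamma> s = fr (r * cos (\<theta> s)) (r * sin (\<theta> s)) h"
    "\<And>s. (\<theta> has_real_derivative \<omega> s) (at s)" "(\<forall>s. \<omega> s > 0) \<or> (\<forall>s. \<omega> s < 0)"
    using circle_angle_function[OF assms(2-8)] by blast
  show ?thesis
  proof (cases "\<forall>s. \<omega> s > 0")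
    case True
    then show ?thesis using that[OF frame *(1,2)] by blast
  next
    case False
    interpret R: adapted_frame g e1 "- e2" c by (rule reflected_frame)
    have "\<gamma> s = R.fr (r * cos (- \<theta> s)) (r * sin (- \<theta> s)) h" for s
      using *(1) by (simp add: R.fr_def fr_def)
    moreover have "((\<lambda>s. - \<theta> s) has_real_derivative - \<omega> s) (at s)" for s
      by (intro derivative_intros *)
    moreover have "- \<omega> s > 0" for s using False *(3) by auto
    ultimately show ?thesis by (rule that[OF R.adapted_frame_axioms])
  qed
qed

text \<open>The increase over a period is 2 pi n with n > 0 by monotonicity. For n > 1 the angle
  would have grown by 2 pi strictly before the period ends, and the curve would meet itself.\<close>

lemma angle_function_quasi_periodic:
  fixes \<theta> :: "real \<Rightarrow> real"
  assumes D: "\<And>s. (\<theta> has_real_derivative \<omega> s) (at s)" and pos: "\<And>s. \<omega> s > 0"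
    and per: "\<And>s. cos (\<theta> (s + 2 * pi)) = cos (\<theta> s)" "\<And>s. sin (\<theta> (s + 2 * pi)) = sin (\<theta> s)"
    and inj: "\<And>s t. s \<in> {0..<2 * pi} \<Longrightarrow> t \<in> {0..<2 * pi} \<Longrightarrow> cos (\<theta> s) = cos (\<theta> t) \<Longrightarrow>
      sin (\<theta> s) = sin (\<theta> t) \<Longrightarrow> s = t"
  shows "\<theta> (s + 2 * pi) = \<theta> s + 2 * pi"
proof -
  have mono: "\<theta> x < \<theta> y" if "x < y" for x y
    using DERIV_pos_imp_increasing[OF that, of \<theta>] D pos by blast
  obtain n :: int where n: "\<theta> (s + 2 * pi) = \<theta> s + 2 * pi * n"
    using sin_cos_eq_iff[of "\<theta> (s + 2 * pi)" "\<theta> s"] per[of s] by auto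
  have "n > 0" using mono[of s "s + 2 * pi"] by (simp add: n zero_less_mult_iff)
  moreover have "\<not> n > 1"
  proof
    assume "n > 1"
    then have "2 * pi * 1 < 2 * pi * of_int n" by (intro mult_strict_left_mono) auto
    then have "\<theta> s + 2 * pi \<le> \<theta> (s + 2 * pi)" by (simp add: n)
    moreover have "continuous_on {s..s + 2 * pi} \<theta>"
      using D by (auto intro!: continuous_at_imp_continuous_on DERIV_isCont)
    ultimately obtain t where t: "s \<le> t" "t \<le> s + 2 * pi" "\<theta> t = \<theta> s + 2 * pi"
      using IVT'[of \<theta> s "\<theta> s + 2 * pi" "s + 2 * pi"] by auto
    have "t \<noteq> s" using t by auto
    moreover have "t \<noteq> s + 2 * pi" using t \<open>2 * pi * 1 < 2 * pi * of_int n\<close> by (auto simp: n)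
    ultimately have st: "s < t" "t < s + 2 * pi" using t by auto
    interpret C: periodic_fun_simple "\<lambda>s. cos (\<theta> s)" "2 * pi" by unfold_locales (rule per)
    interpret S: periodic_fun_simple "\<lambda>s. sin (\<theta> s)" "2 * pi" by unfold_locales (rule per)
    \<comment> \<open>Injectivity is known on [0, 2 pi) only. Removing m whole periods brings s
      there, and t at most one period further, whence the final case distinction.\<close>
    define m where "m = \<lfloor>s / (2 * pi)\<rfloor>"
    define s0 where "s0 = s - of_int m * (2 * pi)"
    define t0 where "t0 = t - of_int m * (2 * pi)"
    have s0: "s0 \<in> {0..<2 * pi}"
      using floor_divide_lower[of "2 * pi" s] floor_divide_upper[of "2 * pi" s]
      by (simp add: s0_def m_def algebra_simps)
    have eq: "cos (\<theta> s0) = cos (\<theta> t0)" "sin (\<theta> s0) = sin (\<theta> t0)"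
      using C.minus_of_int[of s m] C.minus_of_int[of t m] S.minus_of_int[of s m] S.minus_of_int[of t m] t
      by (simp_all add: s0_def t0_def)
    have st0: "s0 < t0" "t0 < s0 + 2 * pi" using st by (simp_all add: s0_def t0_def)
    show False
    proof (cases "t0 < 2 * pi")
      case True
      then show False using inj[OF s0 _ eq] s0 st0 by auto
    next
      case False
      then show False
        using inj[OF s0, of "t0 - 2 * pi"] s0 st0 eq C.minus_1[of t0] S.minus_1[of t0] by auto
    qed
  qed
  ultimately have "n = 1" by simp
  with n show ?thesis by simp
qed

section \<open>First-order variations\<close>

lemma quadratic_bound_imp_deriv_0:
  fixes f :: "real \<Rightarrow> real"
  assumes D: "(f has_real_derivative d) (at 0)" and "\<eta> > 0"
    and bound: "\<And>e. \<bar>e\<bar> < \<eta> \<Longrightarrow> \<bar>f e\<bar> \<le> K * e\<^sup>2"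
  shows "d = 0"
proof (rule LIM_unique)
  have f0: "f 0 = 0" using bound[of 0] \<open>\<eta> > 0\<close> by simp
  show "(\<lambda>h. f h / h) \<midarrow>0\<rightarrow> d" using D by (simp add: DERIV_def f0)
  show "(\<lambda>h. f h / h) \<midarrow>0\<rightarrow> 0"
  proof (rule Lim_null_comparison)
    have "\<forall>\<^sub>F h in at 0. \<bar>h\<bar> < \<eta>"
      using \<open>\<eta> > 0\<close> by (auto simp: eventually_at dist_real_def)
    then show "\<forall>\<^sub>F h in at 0. norm (f h / h) \<le> \<bar>K\<bar> * \<bar>h\<bar>"
    proof eventually_elim
      case (elim h)
      have "\<bar>f h\<bar> \<le> K * h\<^sup>2" by (rule bound[OF elim])
      also have "\<dots> \<le> \<bar>K\<bar> * h\<^sup>2" by (intro mult_right_mono) simp_all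
      also have "\<dots> = \<bar>K\<bar> * \<bar>h\<bar> * \<bar>h\<bar>" by (simp add: power2_eq_square)
      finally show ?case by (cases "h = 0") (simp_all add: divide_le_eq)
    qed
    show "(\<lambda>h. \<bar>K\<bar> * \<bar>h\<bar>) \<midarrow>0\<rightarrow> 0" by (auto intro!: tendsto_eq_intros)
  qed
qed

lemma abs_cos_diff_le: "\<bar>cos x - cos y\<bar> \<le> \<bar>x - y\<bar>" for x y :: real
proof -
  have "norm (cos x - cos y) \<le> 1 * norm (x - y)"
    by (rule field_differentiable_bound[of UNIV cos "\<lambda>x. - sin x"]) (auto intro!: derivative_eq_intros)
  then show ?thesis by simp
qed

lemma has_vector_derivative_unit_tangent:
  assumes X: "(X has_vector_derivative X') (at t)" and pos: "ip g (X t) (X t) > 0"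
  shows "((\<lambda>t. (1 / mnorm g (X t)) *\<^sub>R X t) has_vector_derivative
    (1 / mnorm g (X t)) *\<^sub>R X' - (ip g (X t) X' / mnorm g (X t) ^ 3) *\<^sub>R X t) (at t)"
proof -
  define n where "n = mnorm g (X t)"
  have n: "n > 0" using pos by (simp add: n_def mnorm_def)
  have "((\<lambda>t. ip g (X t) (X t)) has_real_derivative 2 * ip g (X t) X') (at t)"
    using has_real_derivative_ip[OF X X, of g] by (simp add: ip_commute[of g X'])
  from DERIV_chain2[OF DERIV_real_sqrt[OF pos] this]
  have "((\<lambda>t. mnorm g (X t)) has_real_derivative ip g (X t) X' / n) (at t)"
    by (simp add: mnorm_def n_def field_simps)
  from DERIV_inverse'[OF this] n
  have "((\<lambda>t. 1 / mnorm g (X t)) has_real_derivative - (ip g (X t) X' / n ^ 3)) (at t)"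
    by (simp add: n_def[symmetric] inverse_eq_divide field_simps power3_eq_cube)
  from has_vector_derivative_scaleR[OF this X] show ?thesis
    by (simp add: n_def)
qed

text \<open>The squared length is sin^2 or sinh^2 of the distance between x and y. Against vectors
  tangent at x, the projection of y cannot be told from y itself.\<close>

lemma chord_dir_ip:
  assumes "ip g x x = sg g" "ip g y y = sg g"
  shows "ip g (chord_dir g x y) (chord_dir g x y) = sg g * (1 - (ip g x y)\<^sup>2)"
    and "ip g x v = 0 \<Longrightarrow> ip g v (chord_dir g x y) = ip g v y"
proof -
  have s: "1 / sg g = sg g" by (cases g) (simp_all add: sg_def)
  define L where "L = ip g x y"
  have c: "chord_dir g x y = y - (L * sg g) *\<^sub>R x"
    using s by (simp add: chord_dir_def assms L_def divide_inverse)
  have "ip g (chord_dir g x y) (chord_dir g x y) = sg g - 2 * sg g * L\<^sup>2 + (sg g * sg g) * sg g * L\<^sup>2"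
    unfolding c by (simp add: ip_simps assms ip_commute[of g y x] flip: L_def) (simp add: algebra_simps power2_eq_square)
  then show "ip g (chord_dir g x y) (chord_dir g x y) = sg g * (1 - (ip g x y)\<^sup>2)"
    by (simp add: L_def algebra_simps)
  show "ip g v (chord_dir g x y) = ip g v y" if "ip g x v = 0"
    using that by (simp add: c ip_simps ip_commute[of g v x])
qed

text \<open>The denominator is symmetric in the two points, so both contact angles get the same one
  and it can be eliminated later. In the second equation x is the end point of the chord.\<close>

lemma mangle_chord:
  assumes "ip g x x = sg g" "ip g y y = sg g" "ip g x X = 0"
  shows "mangle g X (chord_dir g x y) =
      arccos (ip g ((1 / mnorm g X) *\<^sub>R X) y / sqrt (sg g * (1 - (ip g x y)\<^sup>2)))"
    and "mangle g (- chord_dir g x y) X =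
      arccos (- ip g y ((1 / mnorm g X) *\<^sub>R X) / sqrt (sg g * (1 - (ip g x y)\<^sup>2)))"
  using chord_dir_ip[OF assms(1,2)] assms(3)
  by (simp_all add: mangle_def mnorm_def ip_simps ip_commute[of g "chord_dir g x y" X] ip_commute[of g y X] mult.commute)

text \<open>Equality of the two contact angles up to second order already gives the linear condition:
  with unit tangents \<open>\<tau>\<close> it says \<open>\<langle>\<tau>\<^sub>x, y\<rangle> + \<langle>x, \<tau>\<^sub>y\<rangle> = O(e\<^sup>2)\<close>.\<close>

lemma equal_angles_first_order:
  fixes x y \<tau>x \<tau>y :: "real \<Rightarrow> real^3"
  assumes x: "(x has_vector_derivative x') (at 0)" and y: "(y has_vector_derivative y') (at 0)"
    and \<tau>x: "(\<tau>x has_vector_derivative \<tau>x') (at 0)" and \<tau>y: "(\<tau>y has_vector_derivative \<tau>y') (at 0)"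
    and \<delta>: "\<delta> > 0"
    and S: "S = (\<lambda>e. sqrt (sg g * (1 - (ip g (x e) (y e))\<^sup>2)))" and S0: "S 0 > 0"
    and small: "\<bar>ip g (\<tau>x 0) (y 0)\<bar> < S 0" "\<bar>ip g (x 0) (\<tau>y 0)\<bar> < S 0"
    and ax: "\<And>e. \<bar>e\<bar> < \<delta> \<Longrightarrow> \<bar>arccos (ip g (\<tau>x e) (y e) / S e) - \<alpha>\<bar> \<le> C * e\<^sup>2"
    and ay: "\<And>e. \<bar>e\<bar> < \<delta> \<Longrightarrow> \<bar>arccos (- ip g (x e) (\<tau>y e) / S e) - \<alpha>\<bar> \<le> C * e\<^sup>2"
  shows "ip g (\<tau>x 0) y' + ip g \<tau>x' (y 0) + (ip g (x 0) \<tau>y' + ip g x' (\<tau>y 0)) = 0"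
proof -
  define A where "A e = ip g (\<tau>x e) (y e)" for e
  define B where "B e = ip g (x e) (\<tau>y e)" for e
  have A: "(A has_real_derivative ip g (\<tau>x 0) y' + ip g \<tau>x' (y 0)) (at 0)"
    unfolding A_def[abs_def] by (rule has_real_derivative_ip[OF \<tau>x y])
  have B: "(B has_real_derivative ip g (x 0) \<tau>y' + ip g x' (\<tau>y 0)) (at 0)"
    unfolding B_def[abs_def] by (rule has_real_derivative_ip[OF x \<tau>y])
  have contA: "isCont A 0" and contB: "isCont B 0" using A B DERIV_isCont by blast+
  have contS: "isCont S 0" unfolding S
    by (intro continuous_intros DERIV_isCont[OF has_real_derivative_ip[OF x y]])
  have small': "\<bar>A 0\<bar> < S 0" "\<bar>B 0\<bar> < S 0" using small by (simp_all add: A_def B_def)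
  \<comment> \<open>Only on [-1, 1] does cosine undo \<open>arccos\<close>; strictness at e = 0
    keeps both quotients there for small e. Since cosine is 1-Lipschitz, the bounds on the angles
    pass to the quotients, and \<open>S e < S 0 + 1\<close> makes the constant uniform.\<close>
  have "\<forall>\<^sub>F e in nhds 0. (\<bar>A e\<bar> < S e \<and> \<bar>B e\<bar> < S e) \<and> S e < S 0 + 1 \<and> \<bar>e\<bar> < \<delta>"
  proof (intro eventually_conj)
    have pos: "\<forall>\<^sub>F e in nhds 0. f e > 0" if "isCont f 0" "f 0 > 0" for f :: "real \<Rightarrow> real"
    proof (rule order_tendstoD(1))
      show "(f \<longlongrightarrow> f 0) (nhds 0)" using that(1) by (simp add: isCont_def tendsto_at_iff_tendsto_nhds)
    qed (rule that(2))
    show "\<forall>\<^sub>F e in nhds 0. \<bar>A e\<bar> < S e"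
      using pos[of "\<lambda>e. S e - \<bar>A e\<bar>"] contA contS small'(1) by (simp add: continuous_intros)
    show "\<forall>\<^sub>F e in nhds 0. \<bar>B e\<bar> < S e"
      using pos[of "\<lambda>e. S e - \<bar>B e\<bar>"] contB contS small'(2) by (simp add: continuous_intros)
    show "\<forall>\<^sub>F e in nhds 0. S e < S 0 + 1"
      using pos[of "\<lambda>e. S 0 + 1 - S e"] contS by (simp add: continuous_intros)
    show "\<forall>\<^sub>F e in nhds 0. \<bar>e\<bar> < \<delta>"
      using pos[of "\<lambda>e. \<delta> - \<bar>e\<bar>"] \<delta> by (simp add: continuous_intros)
  qed
  then obtain \<eta> where \<eta>: "\<eta> > 0" and near: "\<And>e. \<bar>e\<bar> < \<eta> \<Longrightarrow>
      \<bar>A e\<bar> < S e \<and> \<bar>B e\<bar> < S e \<and> S e < S 0 + 1 \<and> \<bar>e\<bar> < \<delta>"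
    unfolding eventually_nhds_metric by (auto simp: dist_real_def)
  have "\<bar>A e + B e\<bar> \<le> ((S 0 + 1) * (2 * C)) * e\<^sup>2" if e: "\<bar>e\<bar> < \<eta>" for e
  proof -
    define z w where "z = A e / S e" and "w = - B e / S e"
    note n = near[OF e]
    have Se: "S e > 0" using n by linarith
    have z: "\<bar>z\<bar> \<le> 1" "\<bar>w\<bar> \<le> 1" using n Se by (simp_all add: z_def w_def)
    have "\<bar>arccos z - \<alpha>\<bar> \<le> C * e\<^sup>2" "\<bar>arccos w - \<alpha>\<bar> \<le> C * e\<^sup>2"
      using ax[of e] ay[of e] n by (simp_all add: z_def w_def A_def B_def)
    then have "\<bar>arccos z - arccos w\<bar> \<le> 2 * C * e\<^sup>2" by linarith
    moreover have "\<bar>cos (arccos z) - cos (arccos w)\<bar> \<le> \<bar>arccos z - arccos w\<bar>" by (rule abs_cos_diff_le)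
    ultimately have zw: "\<bar>z - w\<bar> \<le> 2 * C * e\<^sup>2" using z by (simp add: cos_arccos_abs)
    have "A e + B e = S e * (z - w)" using Se by (simp add: z_def w_def field_simps)
    then have "\<bar>A e + B e\<bar> = S e * \<bar>z - w\<bar>" using Se by (simp add: abs_mult)
    also have "\<dots> \<le> (S 0 + 1) * (2 * C * e\<^sup>2)" using n zw Se S0 by (intro mult_mono) auto
    finally show ?thesis by (simp add: mult.assoc)
  qed
  with DERIV_add[OF A B] \<eta> show ?thesis by (rule quadratic_bound_imp_deriv_0)
qed

text \<open>All quantities depend on v - u only, and the two products with unit tangents are
  opposite: this is why the two contact angles of any chord of a circle agree.\<close>

lemma (in adapted_frame) circle_chord:
  fixes r h u v :: real
  assumes r: "r\<^sup>2 + sg g * h\<^sup>2 = sg g"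
  defines "x \<equiv> fr (r * cos u) (r * sin u) h" and "y \<equiv> fr (r * cos v) (r * sin v) h"
  shows "sg g * (1 - (ip g x y)\<^sup>2) = r\<^sup>2 * ((sin (v - u))\<^sup>2 + (h * (1 - cos (v - u)))\<^sup>2)"
    and "ip g (fr (- sin u) (cos u) 0) y = r * sin (v - u)"
    and "ip g x (fr (- sin v) (cos v) 0) = - (r * sin (v - u))"
    and "x \<noteq> y \<Longrightarrow> cos (v - u) \<noteq> 1"
proof -
  have q: "sg g * sg g = 1" by simp
  have L: "ip g x y = r\<^sup>2 * cos (v - u) + sg g * h\<^sup>2"
    by (simp add: x_def y_def ip_fr cos_diff algebra_simps power2_eq_square)
  show "sg g * (1 - (ip g x y)\<^sup>2) = r\<^sup>2 * ((sin (v - u))\<^sup>2 + (h * (1 - cos (v - u)))\<^sup>2)"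
  proof -
    define d where "d = 1 - cos (v - u)"
    have s: "(sin (v - u))\<^sup>2 = d * (2 - d)"
      using sin_cos_squared_add[of "v - u"] by (simp add: d_def power2_eq_square algebra_simps)
    have "sg g * r\<^sup>2 + (sg g * sg g) * h\<^sup>2 = sg g * sg g"
      using arg_cong[OF r, of "\<lambda>x. sg g * x"] by (simp only: distrib_left mult.assoc)
    then have h: "h\<^sup>2 = 1 - sg g * r\<^sup>2" by simp
    have L': "ip g x y = sg g - r\<^sup>2 * d" unfolding L d_def using r by (simp add: algebra_simps)
    show ?thesis unfolding s d_def[symmetric] L' power_mult_distrib h using q by algebra
  qed
  show "ip g (fr (- sin u) (cos u) 0) y = r * sin (v - u)"
    "ip g x (fr (- sin v) (cos v) 0) = - (r * sin (v - u))"
    by (simp_all add: x_def y_def ip_fr sin_diff algebra_simps)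
  show "cos (v - u) \<noteq> 1" if "x \<noteq> y"
  proof
    assume "cos (v - u) = 1"
    moreover from this have "sin (v - u) = 0" using sin_cos_squared_add[of "v - u"] by simp
    ultimately have "sin v = sin u" "cos v = cos u"
      using sin_add[of "v - u" u] cos_add[of "v - u" u] by simp_all
    then show False using that by (simp add: x_def y_def)
  qed
qed

text \<open>\<open>P\<close> and \<open>Q\<close> are the normal and tangential components of the deformation, and the parameter of the
  end point moves with velocity \<open>a\<close>, so that \<open>A\<close> is its total tangential displacement.\<close>

lemma (in adapted_frame) unit_tangent_variation:
  fixes r h \<theta> \<omega> \<omega>' P P' Q Q' a :: real
  assumes r: "r > 0" and \<omega>: "\<omega> > 0"
  defines "X \<equiv> fr (- (r * \<omega> * sin \<theta>)) (r * \<omega> * cos \<theta>) 0"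
  defines "X' \<equiv> fr (h * P' * cos \<theta> - h * P * \<omega> * sin \<theta> - Q' * sin \<theta> - Q * \<omega> * cos \<theta>)
      (h * P' * sin \<theta> + h * P * \<omega> * cos \<theta> + Q' * cos \<theta> - Q * \<omega> * sin \<theta>) (- (sg g * r * P'))
    + a *\<^sub>R fr (- (r * \<omega>' * sin \<theta>) - r * \<omega>\<^sup>2 * cos \<theta>) (r * \<omega>' * cos \<theta> - r * \<omega>\<^sup>2 * sin \<theta>) 0"
  defines "A \<equiv> Q + a * r * \<omega>"
  shows "mnorm g X = r * \<omega>" and "(1 / mnorm g X) *\<^sub>R X = fr (- sin \<theta>) (cos \<theta>) 0"
    and "(1 / mnorm g X) *\<^sub>R X' - (ip g X X' / mnorm g X ^ 3) *\<^sub>R X =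
      fr ((h * (P' / \<omega>) - A) / r * cos \<theta>) ((h * (P' / \<omega>) - A) / r * sin \<theta>) (- (sg g * (P' / \<omega>)))"
proof -
  have t: "(sin \<theta>)\<^sup>2 + (cos \<theta>)\<^sup>2 = 1" by simp
  have "ip g X X = (r * \<omega>)\<^sup>2 * ((sin \<theta>)\<^sup>2 + (cos \<theta>)\<^sup>2)"
    unfolding X_def ip_fr by algebra
  then have "ip g X X = (r * \<omega>)\<^sup>2" unfolding t by simp
  then show n: "mnorm g X = r * \<omega>" using r \<omega> by (simp add: mnorm_def)
  show "(1 / mnorm g X) *\<^sub>R X = fr (- sin \<theta>) (cos \<theta>) 0"
    unfolding n unfolding X_def fr_arith using r \<omega> by (simp add: fr_eq_iff)
  \<comment> \<open>In polar coordinates \<open>X'\<close> has radial component m and tangential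
    component k. Normalising the tangent removes k, and with it \<open>Q'\<close> and
    \<open>\<omega>'\<close>.\<close>
  define k where "k = h * P * \<omega> + Q' + a * r * \<omega>'"
  define m where "m = h * P' - Q * \<omega> - a * r * \<omega>\<^sup>2"
  have X': "X' = fr (m * cos \<theta> - k * sin \<theta>) (m * sin \<theta> + k * cos \<theta>) (- (sg g * r * P'))"
    unfolding X'_def fr_arith fr_eq_iff k_def m_def by (simp add: algebra_simps)
  have "ip g X X' = (r * \<omega>) * k * ((sin \<theta>)\<^sup>2 + (cos \<theta>)\<^sup>2)"
    unfolding X' unfolding X_def ip_fr by algebra
  then have "ip g X X' / mnorm g X ^ 3 = k / (r * \<omega>)\<^sup>2"
    using r \<omega> unfolding t n by (simp add: power2_eq_square power3_eq_cube)
  moreover have "(h * (P' / \<omega>) - A) / r = m / (r * \<omega>)"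
    using r \<omega> by (simp add: m_def A_def field_simps power2_eq_square)
  ultimately show "(1 / mnorm g X) *\<^sub>R X' - (ip g X X' / mnorm g X ^ 3) *\<^sub>R X =
      fr ((h * (P' / \<omega>) - A) / r * cos \<theta>) ((h * (P' / \<omega>) - A) / r * sin \<theta>) (- (sg g * (P' / \<omega>)))"
    unfolding n X' unfolding X_def fr_arith fr_eq_iff using r \<omega>
    by (simp add: field_simps power2_eq_square)
qed

text \<open>\<open>Au\<close> and \<open>Av\<close> are displacements along the circle and cancel;
  \<open>pu\<close> and \<open>pv\<close> stand for angular derivatives of the normal component. The
  common factor h remains, so the relation is void for a great circle.\<close>

lemma (in adapted_frame) linearized_equal_angles:
  fixes u v :: real
  assumes r: "r > 0"
    and eq: "ip g (fr (- sin u) (cos u) 0)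
        (fr (h * Pv * cos v - Av * sin v) (h * Pv * sin v + Av * cos v) (- (sg g * r * Pv)))
      + ip g (fr ((h * pu - Au) / r * cos u) ((h * pu - Au) / r * sin u) (- (sg g * pu)))
        (fr (r * cos v) (r * sin v) h)
      + (ip g (fr (r * cos u) (r * sin u) h)
          (fr ((h * pv - Av) / r * cos v) ((h * pv - Av) / r * sin v) (- (sg g * pv)))
        + ip g (fr (h * Pu * cos u - Au * sin u) (h * Pu * sin u + Au * cos u) (- (sg g * r * Pu)))
          (fr (- sin v) (cos v) 0)) = 0"
  shows "h * ((pu + pv) * (1 - cos (v - u))) = h * (sin (v - u) * (Pv - Pu))"
proof -
  have q: "sg g * sg g = 1" by simp
  define mu where "mu = (h * pu - Au) / r"
  define mv where "mv = (h * pv - Av) / r"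
  have m: "r * mu = h * pu - Au" "r * mv = h * pv - Av" using r by (simp_all add: mu_def mv_def)
  show ?thesis
    using eq m q unfolding ip_fr mu_def[symmetric] mv_def[symmetric] sin_diff cos_diff by algebra
qed

section \<open>First variation of the geodesic curvature\<close>

lemma has_real_derivative_det3:
  assumes "(A has_vector_derivative A') (at t)" "(B has_vector_derivative B') (at t)"
    "(C has_vector_derivative C') (at t)"
  shows "((\<lambda>t. det3 (A t) (B t) (C t)) has_real_derivative
    det3 A' (B t) (C t) + det3 (A t) B' (C t) + det3 (A t) (B t) C') (at t)"
proof -
  have nth: "((\<lambda>t. f t $ i) has_real_derivative f' $ i) (at t)"
    if "(f has_vector_derivative f') (at t)" for f :: "real \<Rightarrow> real^3" and f' i
    unfolding has_real_derivative_iff_has_vector_derivative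
    by (rule bounded_linear.has_vector_derivative[OF bounded_linear_vec_nth that])
  show ?thesis
    unfolding det3_def
    by (rule derivative_eq_intros nth assms refl)+ (simp add: algebra_simps)
qed

lemma has_real_derivative_geodesic_curvature:
  assumes A: "(A has_vector_derivative A') (at t)" and B: "(B has_vector_derivative B') (at t)"
    and C: "(C has_vector_derivative C') (at t)" and n: "mnorm g (B t) = n" "n > 0"
  shows "((\<lambda>t. det3 (A t) (B t) (C t) / mnorm g (B t) ^ 3) has_real_derivative
    (det3 A' (B t) (C t) + det3 (A t) B' (C t) + det3 (A t) (B t) C') / n ^ 3
    - 3 * det3 (A t) (B t) (C t) * ip g (B t) B' / n ^ 5) (at t)"
proof -
  have "mnorm g (B t) > 0" using n by simp
  then have pos: "ip g (B t) (B t) > 0" by (simp add: mnorm_def)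
  have "((\<lambda>t. ip g (B t) (B t)) has_real_derivative 2 * ip g (B t) B') (at t)"
    using has_real_derivative_ip[OF B B, of g] by (simp add: ip_commute[of g B'])
  from DERIV_chain2[OF DERIV_real_sqrt[OF pos] this] n
  have "((\<lambda>t. mnorm g (B t)) has_real_derivative ip g (B t) B' / n) (at t)"
    by (simp add: mnorm_def field_simps)
  from DERIV_power[OF this, of 3] n(1)
  have "((\<lambda>t. mnorm g (B t) ^ 3) has_real_derivative 3 * n * ip g (B t) B') (at t)"
    using n(2) by (simp add: power2_eq_square mult_ac)
  from DERIV_divide[OF has_real_derivative_det3[OF A B C] this] n
  have "((\<lambda>t. det3 (A t) (B t) (C t) / mnorm g (B t) ^ 3) has_real_derivative
      ((det3 A' (B t) (C t) + det3 (A t) B' (C t) + det3 (A t) (B t) C') * n ^ 3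
        - det3 (A t) (B t) (C t) * (3 * n * ip g (B t) B')) / (n ^ 3 * n ^ 3)) (at t)"
    by simp
  then show ?thesis
    by (rule DERIV_cong) (use n(2) in \<open>simp add: field_simps eval_nat_numeral\<close>)
qed

text \<open>The fraction over \<open>\<omega> ^ 3\<close> is the second derivative of the normal
  component with respect to the angle. The tangential component \<open>Q\<close> drops out because a
  circle has constant curvature, so a shift along it has no first-order effect.\<close>

lemma (in adapted_frame) curvature_variation:
  fixes r h \<theta> \<omega> \<omega>' P P' P'' Q Q' Q'' :: real
  assumes r: "r > 0" "r\<^sup>2 + sg g * h\<^sup>2 = sg g" and \<omega>: "\<omega> > 0"
  defines "x \<equiv> fr (r * cos \<theta>) (r * sin \<theta>) h"
    and "X \<equiv> fr (- (r * \<omega> * sin \<theta>)) (r * \<omega> * cos \<theta>) 0"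
    and "Y \<equiv> fr (- (r * \<omega>' * sin \<theta>) - r * \<omega>\<^sup>2 * cos \<theta>) (r * \<omega>' * cos \<theta> - r * \<omega>\<^sup>2 * sin \<theta>) 0"
    and "V \<equiv> fr (h * P * cos \<theta> - Q * sin \<theta>) (h * P * sin \<theta> + Q * cos \<theta>) (- (sg g * r * P))"
    and "W \<equiv> fr (h * P' * cos \<theta> - h * P * \<omega> * sin \<theta> - Q' * sin \<theta> - Q * \<omega> * cos \<theta>)
      (h * P' * sin \<theta> + h * P * \<omega> * cos \<theta> + Q' * cos \<theta> - Q * \<omega> * sin \<theta>) (- (sg g * r * P'))"
    and "Z \<equiv> fr ((h * P'' - h * P * \<omega>\<^sup>2 - 2 * Q' * \<omega> - Q * \<omega>') * cos \<theta>
          - (2 * h * P' * \<omega> + h * P * \<omega>' + Q'' - Q * \<omega>\<^sup>2) * sin \<theta>)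
      ((h * P'' - h * P * \<omega>\<^sup>2 - 2 * Q' * \<omega> - Q * \<omega>') * sin \<theta>
          + (2 * h * P' * \<omega> + h * P * \<omega>' + Q'' - Q * \<omega>\<^sup>2) * cos \<theta>) (- (sg g * r * P''))"
  shows "(det3 V X Y + det3 x W Y + det3 x X Z) / (r * \<omega>) ^ 3 - 3 * det3 x X Y * ip g X W / (r * \<omega>) ^ 5
    = - ((P'' * \<omega> - \<omega>' * P') / \<omega> ^ 3 + P) / r\<^sup>2 * det3 e1 e2 c"
proof -
  define D where "D = det3 e1 e2 c"
  have q: "sg g * sg g = 1" by simp
  have t: "(sin \<theta>)\<^sup>2 + (cos \<theta>)\<^sup>2 = 1" by simp
  have rh: "r\<^sup>2 = sg g - sg g * h\<^sup>2" using r(2) by simp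
  have 0: "det3 x X Y = r\<^sup>2 * h * \<omega> ^ 3 * D"
    unfolding x_def X_def Y_def det3_fr D_def[symmetric] using t by algebra
  have 1: "det3 V X Y = - (sg g * r ^ 3 * \<omega> ^ 3 * P * D)"
    unfolding V_def X_def Y_def det3_fr D_def[symmetric] using t by algebra
  have 2: "det3 x W Y = (r * \<omega>' * P' + h * r * (Q' * \<omega>\<^sup>2 + h * P * \<omega> ^ 3 - Q * \<omega> * \<omega>')) * D"
    unfolding x_def W_def Y_def det3_fr D_def[symmetric] using t q rh by algebra
  have 3: "det3 x X Z = r * \<omega> * (- P'' + h * (2 * Q' * \<omega> + Q * \<omega>') + h\<^sup>2 * \<omega>\<^sup>2 * P) * D"
    unfolding x_def X_def Z_def det3_fr D_def[symmetric] using t q rh by algebra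
  have 4: "ip g X W = r * \<omega> * (Q' + h * P * \<omega>)"
    unfolding X_def W_def ip_fr using t by algebra
  have "det3 V X Y + det3 x W Y + det3 x X Z - 3 * (h * \<omega>) * (r * \<omega> * (Q' + h * P * \<omega>)) * D =
      - r * (P'' * \<omega> - \<omega>' * P' + \<omega> ^ 3 * P) * D"
    unfolding 1 2 3 using q rh by algebra
  moreover have "3 * det3 x X Y * ip g X W / (r * \<omega>) ^ 5 =
      3 * (h * \<omega>) * (r * \<omega> * (Q' + h * P * \<omega>)) * D / (r * \<omega>) ^ 3"
    unfolding 0 4 using r(1) \<omega> by (simp add: field_simps eval_nat_numeral)
  ultimately have "(det3 V X Y + det3 x W Y + det3 x X Z) / (r * \<omega>) ^ 3 - 3 * det3 x X Y * ip g X W / (r * \<omega>) ^ 5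
      = - r * (P'' * \<omega> - \<omega>' * P' + \<omega> ^ 3 * P) * D / (r * \<omega>) ^ 3"
    by (simp only: diff_divide_distrib[symmetric])
  also have "\<dots> = - ((P'' * \<omega> - \<omega>' * P') / \<omega> ^ 3 + P) / r\<^sup>2 * D"
    using r(1) \<omega> by (simp add: field_simps eval_nat_numeral)
  finally show ?thesis unfolding D_def .
qed

section \<open>Infinitesimal Gutkin deformations\<close>

text \<open>Defining P and Q as inner products with a moving frame makes them as differentiable as
  V. The formulas for W and Z then follow by differentiating the decomposition of V, since
  derivatives are unique.\<close>

lemma (in adapted_frame) vector_field_along_circle:
  fixes V W Z :: "real \<Rightarrow> real^3" and \<theta> \<omega> \<omega>' :: "real \<Rightarrow> real" and r h :: real
  assumes r: "r \<noteq> 0" "r\<^sup>2 + sg g * h\<^sup>2 = sg g"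
    and \<theta>: "\<And>s. (\<theta> has_real_derivative \<omega> s) (at s)" and \<omega>: "\<And>s. (\<omega> has_real_derivative \<omega>' s) (at s)"
    and V: "\<And>s. (V has_vector_derivative W s) (at s)" and W: "\<And>s. (W has_vector_derivative Z s) (at s)"
    and tangent: "\<And>s. ip g (V s) (fr (r * cos (\<theta> s)) (r * sin (\<theta> s)) h) = 0"
  obtains P P' P'' Q Q' Q'' where
    "\<And>s. P s = ip g (V s) (fr (h * cos (\<theta> s)) (h * sin (\<theta> s)) (- (sg g * r)))"
    "\<And>s. (P has_real_derivative P' s) (at s)" "\<And>s. (P' has_real_derivative P'' s) (at s)"
    "\<And>s. V s = fr (h * P s * cos (\<theta> s) - Q s * sin (\<theta> s)) (h * P s * sin (\<theta> s) + Q s * cos (\<theta> s))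
      (- (sg g * r * P s))"
    "\<And>s. W s = fr (h * P' s * cos (\<theta> s) - h * P s * \<omega> s * sin (\<theta> s) - Q' s * sin (\<theta> s) - Q s * \<omega> s * cos (\<theta> s))
      (h * P' s * sin (\<theta> s) + h * P s * \<omega> s * cos (\<theta> s) + Q' s * cos (\<theta> s) - Q s * \<omega> s * sin (\<theta> s))
      (- (sg g * r * P' s))"
    "\<And>s. Z s = fr ((h * P'' s - h * P s * (\<omega> s)\<^sup>2 - 2 * Q' s * \<omega> s - Q s * \<omega>' s) * cos (\<theta> s)
        - (2 * h * P' s * \<omega> s + h * P s * \<omega>' s + Q'' s - Q s * (\<omega> s)\<^sup>2) * sin (\<theta> s))
      ((h * P'' s - h * P s * (\<omega> s)\<^sup>2 - 2 * Q' s * \<omega> s - Q s * \<omega>' s) * sin (\<theta> s)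
        + (2 * h * P' s * \<omega> s + h * P s * \<omega>' s + Q'' s - Q s * (\<omega> s)\<^sup>2) * cos (\<theta> s)) (- (sg g * r * P'' s))"
proof -
  \<comment> \<open>\<open>N\<close> is the unit normal of the circle inside the surface and
    \<open>T\<close> its unit tangent; the digits 1 and 2 mark derivatives.\<close>
  define N where "N s = fr (h * cos (\<theta> s)) (h * sin (\<theta> s)) (- (sg g * r))" for s
  define N1 where "N1 s = fr (- (h * \<omega> s * sin (\<theta> s))) (h * \<omega> s * cos (\<theta> s)) 0" for s
  define N2 where "N2 s = fr (- (h * \<omega>' s * sin (\<theta> s)) - h * (\<omega> s)\<^sup>2 * cos (\<theta> s))
    (h * \<omega>' s * cos (\<theta> s) - h * (\<omega> s)\<^sup>2 * sin (\<theta> s)) 0" for s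
  define T where "T s = fr (- sin (\<theta> s)) (cos (\<theta> s)) 0" for s
  define T1 where "T1 s = fr (- (\<omega> s * cos (\<theta> s))) (- (\<omega> s * sin (\<theta> s))) 0" for s
  define T2 where "T2 s = fr (- (\<omega>' s * cos (\<theta> s)) + (\<omega> s)\<^sup>2 * sin (\<theta> s))
    (- (\<omega>' s * sin (\<theta> s)) - (\<omega> s)\<^sup>2 * cos (\<theta> s)) 0" for s
  have N: "(N has_vector_derivative N1 s) (at s)" and N1: "(N1 has_vector_derivative N2 s) (at s)"
    and T: "(T has_vector_derivative T1 s) (at s)" and T1: "(T1 has_vector_derivative T2 s) (at s)" for s
    unfolding N_def[abs_def] N1_def[abs_def] N2_def T_def[abs_def] T1_def[abs_def] T2_def
    by (intro has_vector_derivative_fr;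
        (rule derivative_eq_intros \<theta> \<omega> refl)+; simp add: algebra_simps power2_eq_square)+
  define P where "P s = ip g (V s) (N s)" for s
  define P' where "P' s = ip g (V s) (N1 s) + ip g (W s) (N s)" for s
  define P'' where "P'' s = ip g (V s) (N2 s) + ip g (W s) (N1 s) + (ip g (W s) (N1 s) + ip g (Z s) (N s))" for s
  define Q where "Q s = ip g (V s) (T s)" for s
  define Q' where "Q' s = ip g (V s) (T1 s) + ip g (W s) (T s)" for s
  define Q'' where "Q'' s = ip g (V s) (T2 s) + ip g (W s) (T1 s) + (ip g (W s) (T1 s) + ip g (Z s) (T s))" for s
  have P: "(P has_real_derivative P' s) (at s)" and P': "(P' has_real_derivative P'' s) (at s)"
    and Q: "(Q has_real_derivative Q' s) (at s)" and Q': "(Q' has_real_derivative Q'' s) (at s)" for s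
    unfolding P_def[abs_def] P'_def[abs_def] P''_def Q_def[abs_def] Q'_def[abs_def] Q''_def
    by (intro has_real_derivative_ip DERIV_add V W N N1 T T1)+
  have V_eq: "V s = fr (h * P s * cos (\<theta> s) - Q s * sin (\<theta> s)) (h * P s * sin (\<theta> s) + Q s * cos (\<theta> s))
      (- (sg g * r * P s))" for s
  proof -
    define a b z where "a = ip g (V s) e1" and "b = ip g (V s) e2" and "z = sg g * ip g (V s) c"
    define q where "q = sg g"
    have Vs: "V s = fr a b z" using fr_ip[of "V s"] by (simp add: a_def b_def z_def)
    have q: "q * q = 1" and rh: "r\<^sup>2 + q * h\<^sup>2 = q" using r(2) by (simp_all add: q_def)
    \<comment> \<open>\<open>w\<close> is the radial component of V. Tangency to the surface and the
      unit length of \<open>N\<close> force (w, z) to be P times (h, - q r).\<close>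
    define w where "w = a * cos (\<theta> s) + b * sin (\<theta> s)"
    have tan: "r * w + q * (h * z) = 0"
      using tangent[of s] unfolding Vs ip_fr q_def w_def by (simp add: algebra_simps)
    have Ps: "P s = h * w - (q * q) * (r * z)"
      unfolding P_def N_def Vs ip_fr w_def q_def by (simp add: algebra_simps)
    have Qs: "Q s = - a * sin (\<theta> s) + b * cos (\<theta> s)"
      unfolding Q_def T_def Vs ip_fr by simp
    have t: "(sin (\<theta> s))\<^sup>2 + (cos (\<theta> s))\<^sup>2 = 1" by simp
    have hP: "h * P s = w" using Ps tan rh q by algebra
    have rP: "- (q * r * P s) = z" using Ps tan rh q by algebra
    have "w * cos (\<theta> s) - Q s * sin (\<theta> s) = a" "w * sin (\<theta> s) + Q s * cos (\<theta> s) = b"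
      using t unfolding w_def Qs by algebra+
    then show ?thesis using rP unfolding Vs fr_eq_iff hP q_def by simp
  qed
  have W_eq: "W s = fr (h * P' s * cos (\<theta> s) - h * P s * \<omega> s * sin (\<theta> s) - Q' s * sin (\<theta> s) - Q s * \<omega> s * cos (\<theta> s))
      (h * P' s * sin (\<theta> s) + h * P s * \<omega> s * cos (\<theta> s) + Q' s * cos (\<theta> s) - Q s * \<omega> s * sin (\<theta> s))
      (- (sg g * r * P' s))" for s
  proof (rule vector_derivative_unique_at[OF V])
    show "(V has_vector_derivative fr (h * P' s * cos (\<theta> s) - h * P s * \<omega> s * sin (\<theta> s) - Q' s * sin (\<theta> s) - Q s * \<omega> s * cos (\<theta> s))
      (h * P' s * sin (\<theta> s) + h * P s * \<omega> s * cos (\<theta> s) + Q' s * cos (\<theta> s) - Q s * \<omega> s * sin (\<theta> s))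
      (- (sg g * r * P' s))) (at s)"
      unfolding V_eq[abs_def]
      by (intro has_vector_derivative_fr;
          (rule derivative_eq_intros \<theta> P Q refl)+; simp add: algebra_simps)
  qed
  have Z_eq: "Z s = fr ((h * P'' s - h * P s * (\<omega> s)\<^sup>2 - 2 * Q' s * \<omega> s - Q s * \<omega>' s) * cos (\<theta> s)
        - (2 * h * P' s * \<omega> s + h * P s * \<omega>' s + Q'' s - Q s * (\<omega> s)\<^sup>2) * sin (\<theta> s))
      ((h * P'' s - h * P s * (\<omega> s)\<^sup>2 - 2 * Q' s * \<omega> s - Q s * \<omega>' s) * sin (\<theta> s)
        + (2 * h * P' s * \<omega> s + h * P s * \<omega>' s + Q'' s - Q s * (\<omega> s)\<^sup>2) * cos (\<theta> s)) (- (sg g * r * P'' s))"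
    (is "_ = ?Z s") for s
  proof (rule vector_derivative_unique_at[OF W])
    show "(W has_vector_derivative ?Z s) (at s)"
      unfolding W_eq[abs_def]
      by (intro has_vector_derivative_fr;
          (rule derivative_eq_intros \<theta> \<omega> P P' Q Q' refl)+; simp add: algebra_simps power2_eq_square)
  qed
  show ?thesis
    by (rule that[of P P' P'' Q Q' Q'']) (rule P P' V_eq W_eq Z_eq | simp add: P_def N_def)+
qed

text \<open>With k = |h| (1 - cos \<beta>) and n^2 = sin^2 \<beta> + k^2, the cosine of \<alpha> is
  sin \<beta> / n, and its sine is k / n because the sine is nonnegative on the range of
  \<open>arccos\<close>. This is the origin of the absolute value of h.\<close>

lemma contact_angle_cot:
  fixes r h \<beta> :: real
  assumes r: "r > 0" and h: "h \<noteq> 0" and \<beta>: "cos \<beta> \<noteq> 1"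
    and \<alpha>: "arccos (r * sin \<beta> / sqrt (r\<^sup>2 * ((sin \<beta>)\<^sup>2 + (h * (1 - cos \<beta>))\<^sup>2))) = \<alpha>"
  shows "sin \<beta> = \<bar>h\<bar> * cot \<alpha> * (1 - cos \<beta>)"
proof -
  define k where "k = \<bar>h\<bar> * (1 - cos \<beta>)"
  have k: "k > 0" using h \<beta> cos_le_one[of \<beta>] by (simp add: k_def less_le)
  define n where "n = sqrt ((sin \<beta>)\<^sup>2 + k\<^sup>2)"
  have n2: "n\<^sup>2 = (sin \<beta>)\<^sup>2 + k\<^sup>2" unfolding n_def by (rule real_sqrt_pow2) simp
  have n: "n > 0" unfolding n_def using k by (simp add: add_nonneg_pos)
  have "sqrt (r\<^sup>2 * ((sin \<beta>)\<^sup>2 + (h * (1 - cos \<beta>))\<^sup>2)) = r * n"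
    using r by (simp add: n_def k_def real_sqrt_mult power_mult_distrib)
  then have \<alpha>': "arccos (sin \<beta> / n) = \<alpha>" using \<alpha> r by simp
  have "(sin \<beta>)\<^sup>2 \<le> n\<^sup>2" using n2 by simp
  then have "(sin \<beta> / n)\<^sup>2 \<le> 1" using n unfolding power_divide by (subst divide_le_eq_1_pos) simp_all
  then have z: "\<bar>sin \<beta> / n\<bar> \<le> 1" by (simp only: abs_square_le_1)
  have cos\<alpha>: "cos \<alpha> = sin \<beta> / n" unfolding \<alpha>'[symmetric] using z by (rule cos_arccos_abs)
  have "sin \<alpha> = sqrt (1 - (sin \<beta> / n)\<^sup>2)"
    unfolding \<alpha>'[symmetric] by (rule sin_arccos) (use z in linarith)+
  also have "1 - (sin \<beta> / n)\<^sup>2 = (k / n)\<^sup>2"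
  proof -
    have "k\<^sup>2 = n\<^sup>2 - (sin \<beta>)\<^sup>2" using n2 by simp
    then show ?thesis using n unfolding power_divide by (simp add: diff_divide_distrib)
  qed
  finally have sin\<alpha>: "sin \<alpha> = k / n" using k n by simp
  have "cot \<alpha> * k = sin \<beta>" using k n by (simp add: cot_def cos\<alpha> sin\<alpha>)
  then show ?thesis by (simp add: k_def mult_ac)
qed

text \<open>The hypotheses say cot (\<beta> / 2) = m = cot \<gamma>, so \<beta> / 2 and \<gamma>
  differ by a multiple of pi. The proof avoids half angles: cosine and sine of \<beta> and of 2
  \<gamma> are the same functions of m.\<close>

lemma eq_double_angle:
  fixes \<beta> \<gamma> m :: real
  assumes \<beta>: "sin \<beta> = m * (1 - cos \<beta>)" "cos \<beta> \<noteq> 1" and \<gamma>: "cos \<gamma> = m * sin \<gamma>" "sin \<gamma> \<noteq> 0"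
  obtains n :: int where "\<beta> = 2 * \<gamma> + 2 * pi * n"
proof -
  define d where "d = 1 - cos \<beta>"
  have d: "d \<noteq> 0" using \<beta> by (simp add: d_def)
  have "d * (m\<^sup>2 * d + d - 2) = 0"
    using \<beta>(1) sin_cos_squared_add[of \<beta>] unfolding d_def by algebra
  with d have "m\<^sup>2 * d + d - 2 = 0" by simp
  moreover have "(sin \<gamma>)\<^sup>2 * (m\<^sup>2 + 1) = 1" using \<gamma>(1) sin_cos_squared_add[of \<gamma>] by algebra
  ultimately have "d = 2 * (sin \<gamma>)\<^sup>2" by algebra
  then have "cos \<beta> = cos (2 * \<gamma>)" "sin \<beta> = sin (2 * \<gamma>)"
    using \<beta>(1) \<gamma>(1) unfolding d_def cos_double_sin sin_double by (simp_all add: power2_eq_square)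
  then show ?thesis using that sin_cos_eq_iff[of \<beta> "2 * \<gamma>"] by blast
qed

text \<open>\<open>arccos\<close> and \<open>arcosh\<close> can be inverted only on their proper
  domains. On the sphere the norm condition bounds the height z by 1; in the hyperbolic case it
  gives |z| at least 1, and z is positive by Cauchy-Schwarz in the first two coordinates, as both
  points lie on the upper sheet.\<close>

lemma mcircle_height:
  assumes c: "c \<in> model g" and p: "p \<in> mcircle g c R"
  shows "ip g p c = sg g * (case g of Sphere \<Rightarrow> cos R | Hyperbolic \<Rightarrow> cosh R)"
proof -
  from adapted_frame_exists[OF c] obtain e1 e2 where "adapted_frame g e1 e2 c" by blast
  then interpret adapted_frame g e1 e2 c .
  define a b z where "a = ip g p e1" and "b = ip g p e2" and "z = sg g * ip g p c"
  have pm: "p \<in> model g" and R: "mdist g p c = R" using p by (auto simp: mcircle_def)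
  have "p = fr a b z" using fr_ip[of p] by (simp add: a_def b_def z_def)
  then have pz: "ip g p c = sg g * z" and "a * a + b * b + sg g * (z * z) = sg g"
    using model_ip[OF pm] ip_fr[of a b z a b z] ip_fr_frame(3)[of a b z] by simp_all
  then have norm: "a\<^sup>2 + b\<^sup>2 = sg g * (1 - z\<^sup>2)" by (simp add: power2_eq_square algebra_simps)
  show ?thesis
  proof (cases g)
    case Sphere
    have "z\<^sup>2 \<le> 1" using norm sum_power2_ge_zero[of a b] by (simp add: Sphere sg_def)
    then have "\<bar>z\<bar> \<le> 1" by (simp only: abs_square_le_1)
    then show ?thesis using R pz by (auto simp: Sphere sg_def mdist_def cos_arccos_abs)
  next
    case Hyperbolic
    have "1 \<le> z\<^sup>2" using norm sum_power2_ge_zero[of a b] by (simp add: Hyperbolic sg_def)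
    then have z: "1 \<le> \<bar>z\<bar>" using abs_le_square_iff[of 1 z] by simp
    have p3: "p $ 3 > 0" and c3: "c $ 3 > 0" and p': "(p $ 1)\<^sup>2 + (p $ 2)\<^sup>2 < (p $ 3)\<^sup>2"
      and c': "(c $ 1)\<^sup>2 + (c $ 2)\<^sup>2 < (c $ 3)\<^sup>2"
      using pm c by (auto simp: Hyperbolic model_def ip_def sg_def power2_eq_square)
    have "(p $ 1 * c $ 1 + p $ 2 * c $ 2)\<^sup>2 \<le> ((p $ 1)\<^sup>2 + (p $ 2)\<^sup>2) * ((c $ 1)\<^sup>2 + (c $ 2)\<^sup>2)"
      using zero_le_power2[of "p $ 1 * c $ 2 - p $ 2 * c $ 1"] by (simp add: power2_eq_square algebra_simps)
    also have "\<dots> < (p $ 3)\<^sup>2 * (c $ 3)\<^sup>2"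
      using p' c' by (intro mult_strict_mono') simp_all
    finally have "(p $ 1 * c $ 1 + p $ 2 * c $ 2)\<^sup>2 < (p $ 3 * c $ 3)\<^sup>2" by (simp add: power_mult_distrib)
    then have "p $ 1 * c $ 1 + p $ 2 * c $ 2 < p $ 3 * c $ 3"
      by (rule power2_less_imp_less) (use p3 c3 in simp)
    then have "z > 0" using pz by (simp add: Hyperbolic sg_def ip_def)
    with z have "1 \<le> z" by simp
    then show ?thesis using R pz by (auto simp: Hyperbolic sg_def mdist_def cosh_arcosh_real)
  qed
qed

text \<open>Here \<gamma> is any solution of cot \<gamma> = |h| cot \<alpha>, hence known modulo pi.
  Stating the resonance with cosine and sine avoids the poles of the tangent.\<close>

lemma nontrivial_deformation_resonance:
  fixes R \<alpha> \<gamma> h :: real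
  assumes deform: "nontrivial_inf_gutkin_deformation g R \<alpha>"
    and h: "h = (case g of Sphere \<Rightarrow> cos R | Hyperbolic \<Rightarrow> cosh R)" "h \<noteq> 0"
    and \<gamma>: "cos \<gamma> = \<bar>h\<bar> * cot \<alpha> * sin \<gamma>" "sin \<gamma> \<noteq> 0"
  shows "\<exists>k::nat. k \<ge> 2 \<and> real k * cos (real k * \<gamma>) = \<bar>h\<bar> * cot \<alpha> * sin (real k * \<gamma>)"
proof (rule ccontr)
  assume no: "\<not> ?thesis"
  from deform[unfolded nontrivial_inf_gutkin_deformation_def]
  obtain G :: "real \<Rightarrow> real \<Rightarrow> real^3" and \<phi> \<psi> :: "real \<Rightarrow> real \<Rightarrow> real" and \<delta> C s\<^sub>1 s\<^sub>2 :: real and c :: "real^3"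
    where \<delta>: "\<delta> > 0"
      and smG: "smooth_fun (\<lambda>(e, s). G e s)" and sm\<phi>: "smooth_fun (\<lambda>(e, t). \<phi> e t)"
      and sm\<psi>: "smooth_fun (\<lambda>(e, t). \<psi> e t)"
      and curve: "\<forall>e s. \<bar>e\<bar> < \<delta> \<longrightarrow> G e s \<in> model g \<and> G e (s + 2 * pi) = G e s \<and>
         mnorm g (d_s G e s) > 0 \<and> gcurv g G e s \<noteq> 0"
      and inj: "\<forall>e s1 s2. \<bar>e\<bar> < \<delta> \<longrightarrow> s1 \<in> {0..<2*pi} \<longrightarrow> s2 \<in> {0..<2*pi} \<longrightarrow> G e s1 = G e s2 \<longrightarrow> s1 = s2"
      and chords: "\<forall>e t. \<bar>e\<bar> < \<delta> \<longrightarrow>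
         deriv (\<lambda>t'. \<phi> e t') t > 0 \<and> deriv (\<lambda>t'. \<psi> e t') t > 0 \<and>
         \<phi> e (t + 2 * pi) = \<phi> e t + 2 * pi \<and> \<psi> e (t + 2 * pi) = \<psi> e t + 2 * pi \<and>
         G e (\<phi> e t) \<noteq> G e (\<psi> e t)"
      and angles: "\<forall>e t. \<bar>e\<bar> < \<delta> \<longrightarrow>
         \<bar>angle_x g G \<phi> \<psi> e t - \<alpha>\<bar> \<le> C * e\<^sup>2 \<and> \<bar>angle_y g G \<phi> \<psi> e t - \<alpha>\<bar> \<le> C * e\<^sup>2"
      and c: "c \<in> model g" and circle: "range (G 0) = mcircle g c R"
      and nonconst: "deriv (\<lambda>e. gcurv g G e s\<^sub>1) 0 \<noteq> deriv (\<lambda>e. gcurv g G e s\<^sub>2) 0"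
    by (elim exE conjE)

  \<comment> \<open>Partial derivatives of the family up to third order\<close>
  obtain Ge Gs where smGe: "smooth_fun (\<lambda>(e, s). Ge e s)" and smGs: "smooth_fun (\<lambda>(e, s). Gs e s)"
    and G: "\<And>e s. ((\<lambda>(e, s). G e s) has_derivative (\<lambda>(a, b). a *\<^sub>R Ge e s + b *\<^sub>R Gs e s)) (at (e, s))"
    by (rule smooth_fun_partials[OF smG]) (rule that)
  obtain Gse Gss where smGse: "smooth_fun (\<lambda>(e, s). Gse e s)" and smGss: "smooth_fun (\<lambda>(e, s). Gss e s)"
    and Gs: "\<And>e s. ((\<lambda>(e, s). Gs e s) has_derivative (\<lambda>(a, b). a *\<^sub>R Gse e s + b *\<^sub>R Gss e s)) (at (e, s))"
    by (rule smooth_fun_partials[OF smGs]) (rule that)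
  obtain Gsse Gsss where smGsse: "smooth_fun (\<lambda>(e, s). Gsse e s)"
    and Gss: "\<And>e s. ((\<lambda>(e, s). Gss e s) has_derivative (\<lambda>(a, b). a *\<^sub>R Gsse e s + b *\<^sub>R Gsss e s)) (at (e, s))"
    by (rule smooth_fun_partials[OF smGss]) (rule that)
  obtain \<phi>e \<phi>s where \<phi>: "\<And>e s. ((\<lambda>(e, s). \<phi> e s) has_derivative (\<lambda>(a, b). a *\<^sub>R \<phi>e e s + b *\<^sub>R \<phi>s e s)) (at (e, s))"
    by (rule smooth_fun_partials[OF sm\<phi>]) (rule that)
  obtain \<psi>e \<psi>s where \<psi>: "\<And>e s. ((\<lambda>(e, s). \<psi> e s) has_derivative (\<lambda>(a, b). a *\<^sub>R \<psi>e e s + b *\<^sub>R \<psi>s e s)) (at (e, s))"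
    by (rule smooth_fun_partials[OF sm\<psi>]) (rule that)
  note dG = partial_derivatives[OF G] and dGs = partial_derivatives[OF Gs] and dGss = partial_derivatives[OF Gss]
    and d\<phi> = partial_derivatives[OF \<phi>] and d\<psi> = partial_derivatives[OF \<psi>]
  have slice: "continuous_on UNIV (F e)" if "smooth_fun (\<lambda>(e, s). F e s)" for F :: "real \<Rightarrow> real \<Rightarrow> real^3" and e
    using continuous_on_compose2[OF smooth_fun_continuous[OF that, of UNIV], of UNIV "\<lambda>s. (e, s)"]
    by (simp add: continuous_on_Pair)
  have d_s: "d_s G = Gs" unfolding d_s_def[abs_def] by (intro ext vector_derivative_at dG(2))
  have dd_s: "dd_s G = Gss" unfolding dd_s_def[abs_def] d_s by (intro ext vector_derivative_at dGs(2))
  have dGe: "(Ge e has_vector_derivative Gse e s) (at s)" for e s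
    by (rule mixed_partial_derivatives_commute[where e = e, OF dG dGs(1) slice[OF smGs] smooth_fun_continuous[OF smGse]])
  have dGse: "(Gse e has_vector_derivative Gsse e s) (at s)" for e s
    by (rule mixed_partial_derivatives_commute[where e = e, OF dGs dGss(1) slice[OF smGss] smooth_fun_continuous[OF smGsse]])

  \<comment> \<open>Constraints on the curve and its variation field\<close>
  have onM: "ip g (G e s) (G e s) = sg g" if "\<bar>e\<bar> < \<delta>" for e s
    using curve that model_ip by blast
  have perG: "G e (s + 2 * pi) = G e s" if "\<bar>e\<bar> < \<delta>" for e s using curve that by blast
  have reg: "ip g (Gs e s) (Gs e s) > 0" if "\<bar>e\<bar> < \<delta>" for e s
    using curve that unfolding d_s mnorm_def real_sqrt_gt_0_iff by blast
  have tangG: "ip g (G e s) (Gs e s) = 0" if e: "\<bar>e\<bar> < \<delta>" for e s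
  proof -
    have "((\<lambda>s. sg g) has_real_derivative ip g (G e s) (Gs e s) + ip g (Gs e s) (G e s)) (at s)"
      using has_real_derivative_ip[OF dG(2)[of e s] dG(2)[of e s], of g] unfolding onM[OF e] .
    from DERIV_unique[OF this DERIV_const] show ?thesis by (simp add: ip_commute[of g "Gs e s"])
  qed
  have open\<delta>: "open {- \<delta><..<\<delta>}" "0 \<in> {- \<delta><..<\<delta>}" using \<delta> by auto
  have tangV: "ip g (Ge 0 s) (G 0 s) = 0" for s
  proof -
    have "((\<lambda>e. sg g) has_real_derivative ip g (G 0 s) (Ge 0 s) + ip g (Ge 0 s) (G 0 s)) (at 0)"
      by (rule has_field_derivative_transform_within_open[OF has_real_derivative_ip[OF dG(1) dG(1)] open\<delta>])
        (simp add: onM abs_less_iff)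
    from DERIV_unique[OF this DERIV_const] show ?thesis by (simp add: ip_commute[of g "G 0 s"])
  qed
  have perV: "Ge 0 (s + 2 * pi) = Ge 0 s" for s
  proof (rule vector_derivative_unique_at)
    show "((\<lambda>e. G e (s + 2 * pi)) has_vector_derivative Ge 0 (s + 2 * pi)) (at 0)" by (rule dG)
    show "((\<lambda>e. G e (s + 2 * pi)) has_vector_derivative Ge 0 s) (at 0)"
      by (rule has_vector_derivative_transform_within_open[OF dG(1) open\<delta>]) (simp add: perG abs_less_iff)
  qed
  have height: "ip g (G 0 s) c = sg g * h" for s
    using mcircle_height[OF c, of "G 0 s" R] circle h(1) by auto

  obtain e1 e2 where frame: "adapted_frame g e1 e2 c"
    by (rule adapted_frame_exists[OF c]) (rule that)
  \<comment> \<open>In the coordinates of the frame the circle is a Euclidean circle of radius r,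
    which is |sin R| or |sinh R|. If r were not positive, the curve would stay at one point of the
    axis, contrary to regularity.\<close>
  define r where "r = sqrt (sg g * (1 - h\<^sup>2))"
  have rpos: "sg g * (1 - h\<^sup>2) > 0"
  proof (rule ccontr)
    interpret adapted_frame g e1 e2 c by (rule frame)
    assume nonpos: "\<not> sg g * (1 - h\<^sup>2) > 0"
    have "G 0 s = fr 0 0 h" for s
    proof -
      define a b where "a = ip g (G 0 s) e1" and "b = ip g (G 0 s) e2"
      have Gs0: "G 0 s = fr a b h" using fr_ip[of "G 0 s"] by (simp add: a_def b_def height flip: mult.assoc)
      then have "a * a + b * b + sg g * (h * h) = sg g" using onM[of 0 s] \<delta> ip_fr[of a b h a b h] by simp
      then have "a\<^sup>2 + b\<^sup>2 = sg g * (1 - h\<^sup>2)" by (simp add: power2_eq_square algebra_simps)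
      then have "a\<^sup>2 + b\<^sup>2 = 0" using nonpos sum_power2_ge_zero[of a b] by linarith
      then show ?thesis unfolding Gs0 by (simp add: sum_power2_eq_zero_iff)
    qed
    then have "G 0 = (\<lambda>_. fr 0 0 h)" by (intro ext)
    then have "(G 0 has_vector_derivative 0) (at 0)" by simp
    from vector_derivative_unique_at[OF dG(2) this] have "Gs 0 0 = 0" .
    then show False using reg[of 0 0] \<delta> by (simp add: ip_def)
  qed
  then have r: "r > 0" and r2: "r\<^sup>2 = sg g * (1 - h\<^sup>2)" by (simp_all add: r_def)
  have rh: "r\<^sup>2 + sg g * h\<^sup>2 = sg g" by (simp add: r2 algebra_simps)

  have zero\<delta>: "\<bar>0\<bar> < \<delta>" using \<delta> by simp
  obtain e2' \<theta> \<omega> where frame': "adapted_frame g e1 e2' c"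
    and G0: "\<And>s. G 0 s = adapted_frame.fr e1 e2' c (r * cos (\<theta> s)) (r * sin (\<theta> s)) h"
    and \<theta>: "\<And>s. (\<theta> has_real_derivative \<omega> s) (at s)" and \<omega>pos: "\<And>s. \<omega> s > 0"
    by (rule circle_angle_parametrization[OF frame r rh dG(2) slice[OF smGs] onM[OF zero\<delta>] height reg[OF zero\<delta>]])
      (rule that)
  interpret adapted_frame g e1 e2' c by (rule frame')
  have Gs0: "Gs 0 s = fr (- (r * \<omega> s * sin (\<theta> s))) (r * \<omega> s * cos (\<theta> s)) 0" for s
  proof (rule vector_derivative_unique_at[OF dG(2)])
    show "(G 0 has_vector_derivative fr (- (r * \<omega> s * sin (\<theta> s))) (r * \<omega> s * cos (\<theta> s)) 0) (at s)"
      unfolding G0[abs_def]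
      by (intro has_vector_derivative_fr; (rule derivative_eq_intros \<theta> refl)+; simp)
  qed
  define T where "T s = fr (- sin (\<theta> s)) (cos (\<theta> s)) 0" for s
  define T1 where "T1 s = fr (- (\<omega> s * cos (\<theta> s))) (- (\<omega> s * sin (\<theta> s))) 0" for s
  have T: "(T has_vector_derivative T1 s) (at s)" for s
    unfolding T_def[abs_def] T1_def
    by (intro has_vector_derivative_fr; (rule derivative_eq_intros \<theta> refl)+; simp)
  \<comment> \<open>So far \<omega> is known only as the positive derivative of \<theta>. Expressing
    it through \<open>Gs 0\<close> and \<open>T\<close> shows that it is differentiable.\<close>
  have \<omega>_eq: "\<omega> s = ip g (Gs 0 s) (T s) / r" for s
  proof -
    have "ip g (Gs 0 s) (T s) = r * \<omega> s * ((sin (\<theta> s))\<^sup>2 + (cos (\<theta> s))\<^sup>2)"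
      unfolding Gs0 T_def ip_fr by algebra
    then show ?thesis using r by simp
  qed
  define \<omega>' where "\<omega>' s = (ip g (Gs 0 s) (T1 s) + ip g (Gss 0 s) (T s)) / r" for s
  have \<omega>: "(\<omega> has_real_derivative \<omega>' s) (at s)" for s
    unfolding \<omega>_eq[abs_def] \<omega>'_def by (intro DERIV_cdivide has_real_derivative_ip dGs T)
  have Gss0: "Gss 0 s = fr (- (r * \<omega>' s * sin (\<theta> s)) - r * (\<omega> s)\<^sup>2 * cos (\<theta> s))
      (r * \<omega>' s * cos (\<theta> s) - r * (\<omega> s)\<^sup>2 * sin (\<theta> s)) 0" (is "_ = ?Y s") for s
  proof (rule vector_derivative_unique_at[OF dGs(2)])
    show "(Gs 0 has_vector_derivative ?Y s) (at s)"
      unfolding Gs0[abs_def]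
      by (intro has_vector_derivative_fr; (rule derivative_eq_intros \<theta> \<omega> refl)+;
          simp add: algebra_simps power2_eq_square)
  qed
  have G0_eq_iff: "G 0 s = G 0 t \<longleftrightarrow> cos (\<theta> s) = cos (\<theta> t) \<and> sin (\<theta> s) = sin (\<theta> t)" for s t
    unfolding G0 fr_eq_iff using r by simp
  have \<theta>per: "\<theta> (s + 2 * pi) = \<theta> s + 2 * pi" for s
  proof (rule angle_function_quasi_periodic[OF \<theta> \<omega>pos])
    show "cos (\<theta> (s + 2 * pi)) = cos (\<theta> s)" "sin (\<theta> (s + 2 * pi)) = sin (\<theta> s)" for s
      using perG[OF zero\<delta>, of s] unfolding G0_eq_iff by simp_all
    show "s = t" if "s \<in> {0..<2 * pi}" "t \<in> {0..<2 * pi}" "cos (\<theta> s) = cos (\<theta> t)" "sin (\<theta> s) = sin (\<theta> t)" for s t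
    proof -
      have "G 0 s = G 0 t" using that(3,4) unfolding G0_eq_iff by simp
      then show ?thesis by (rule inj[rule_format, OF zero\<delta> that(1,2)])
    qed
  qed
  have tangV': "ip g (Ge 0 s) (fr (r * cos (\<theta> s)) (r * sin (\<theta> s)) h) = 0" for s
    using tangV[of s] unfolding G0 .

  \<comment> \<open>Components of the variation field and variation of the curvature\<close>
  obtain P P' P'' Q Q' Q'' where
    P_ip: "\<And>s. P s = ip g (Ge 0 s) (fr (h * cos (\<theta> s)) (h * sin (\<theta> s)) (- (sg g * r)))"
    and P: "\<And>s. (P has_real_derivative P' s) (at s)" and P': "\<And>s. (P' has_real_derivative P'' s) (at s)"
    and V: "\<And>s. Ge 0 s = fr (h * P s * cos (\<theta> s) - Q s * sin (\<theta> s)) (h * P s * sin (\<theta> s) + Q s * cos (\<theta> s))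
      (- (sg g * r * P s))"
    and W: "\<And>s. Gse 0 s = fr (h * P' s * cos (\<theta> s) - h * P s * \<omega> s * sin (\<theta> s) - Q' s * sin (\<theta> s) - Q s * \<omega> s * cos (\<theta> s))
      (h * P' s * sin (\<theta> s) + h * P s * \<omega> s * cos (\<theta> s) + Q' s * cos (\<theta> s) - Q s * \<omega> s * sin (\<theta> s))
      (- (sg g * r * P' s))"
    and Z: "\<And>s. Gsse 0 s = fr ((h * P'' s - h * P s * (\<omega> s)\<^sup>2 - 2 * Q' s * \<omega> s - Q s * \<omega>' s) * cos (\<theta> s)
        - (2 * h * P' s * \<omega> s + h * P s * \<omega>' s + Q'' s - Q s * (\<omega> s)\<^sup>2) * sin (\<theta> s))
      ((h * P'' s - h * P s * (\<omega> s)\<^sup>2 - 2 * Q' s * \<omega> s - Q s * \<omega>' s) * sin (\<theta> s)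
        + (2 * h * P' s * \<omega> s + h * P s * \<omega>' s + Q'' s - Q s * (\<omega> s)\<^sup>2) * cos (\<theta> s)) (- (sg g * r * P'' s))"
    by (rule vector_field_along_circle[OF less_imp_neq[OF r, symmetric] rh \<theta> \<omega> dGe dGse tangV']) (rule that)

  have curv: "deriv (\<lambda>e. gcurv g G e s) 0 =
      - ((P'' s * \<omega> s - \<omega>' s * P' s) / \<omega> s ^ 3 + P s) / r\<^sup>2 * det3 e1 e2' c" for s
  proof (rule DERIV_imp_deriv)
    have n: "mnorm g (Gs 0 s) = r * \<omega> s"
      using unit_tangent_variation(1)[OF r \<omega>pos, of s "\<theta> s"] unfolding Gs0 .
    have n0: "r * \<omega> s > 0" using r \<omega>pos by simp
    show "((\<lambda>e. gcurv g G e s) has_real_derivative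
        - ((P'' s * \<omega> s - \<omega>' s * P' s) / \<omega> s ^ 3 + P s) / r\<^sup>2 * det3 e1 e2' c) (at 0)"
      using has_real_derivative_geodesic_curvature[OF dG(1)[of s 0] dGs(1)[of s 0] dGss(1)[of s 0] n n0]
      unfolding gcurv_def d_s dd_s G0 Gs0 Gss0 V W Z curvature_variation[OF r rh \<omega>pos] .
  qed

  \<comment> \<open>The normal component as a function of the angle\<close>
  obtain J where J: "\<And>s. J (\<theta> s) = s" "\<And>u. \<theta> (J u) = u"
    "\<And>u. (J has_real_derivative 1 / \<omega> (J u)) (at u)" "\<And>u. J (u + 2 * pi) = J u + 2 * pi"
    by (rule quasi_periodic_inverse[OF \<theta> \<omega>pos \<theta>per]) (rule that)
  define p where "p u = P (J u)" for u
  define p' where "p' u = P' (J u) / \<omega> (J u)" for u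
  have p: "(p has_real_derivative p' u) (at u)" for u
    using DERIV_chain2[OF P J(3)] unfolding p_def[abs_def] p'_def by simp
  have contp': "continuous_on UNIV p'"
  proof (rule continuous_at_imp_continuous_on, rule ballI)
    fix u
    have "isCont (\<lambda>u. P' (J u)) u" "isCont (\<lambda>u. \<omega> (J u)) u"
      by (rule DERIV_isCont[OF DERIV_chain2[OF P' J(3)]], rule DERIV_isCont[OF DERIV_chain2[OF \<omega> J(3)]])
    then show "isCont p' u"
      unfolding p'_def[abs_def] using \<omega>pos[of "J u"] by (intro continuous_divide) auto
  qed
  have Pper: "P (s + 2 * pi) = P s" for s unfolding P_ip perV \<theta>per by simp
  have pper: "p (u + 2 * pi) = p u" for u unfolding p_def J Pper ..

  \<comment> \<open>The functional equation\<close>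
  define m where "m = \<bar>h\<bar> * cot \<alpha>"
  have \<gamma>': "cos \<gamma> = m * sin \<gamma>" using \<gamma>(1) by (simp add: m_def)
  have feq: "p' u + p' (u + 2 * \<gamma>) = m * (p (u + 2 * \<gamma>) - p u)" for u
  proof -
    \<comment> \<open>The time t is chosen such that the chord starts at the given angle u; its
      other end has the angle v. In this way the relation for single chords holds at every
      u.\<close>
    have cont\<phi>: "continuous_on UNIV (\<phi> 0)"
      using d\<phi>(2) by (auto intro!: continuous_at_imp_continuous_on has_vector_derivative_continuous)
    have "\<phi> 0 (t + 2 * pi) = \<phi> 0 t + 2 * pi" for t using chords zero\<delta> by blast
    then obtain t where t: "\<phi> 0 t = J u" using quasi_periodic_surj[OF cont\<phi>] by blast
    define s1 where "s1 = \<phi> 0 t"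
    define s2 where "s2 = \<psi> 0 t"
    define v where "v = \<theta> s2"
    have u: "\<theta> s1 = u" by (simp add: s1_def t J)
    have q\<phi>: "((\<lambda>e. \<phi> e t) has_vector_derivative \<phi>e 0 t) (at 0)"
      and q\<psi>: "((\<lambda>e. \<psi> e t) has_vector_derivative \<psi>e 0 t) (at 0)" by (rule d\<phi> d\<psi>)+
    have pt: "((\<lambda>e. G e (q e)) has_vector_derivative
          fr (h * P s * cos (\<theta> s) - A * sin (\<theta> s)) (h * P s * sin (\<theta> s) + A * cos (\<theta> s)) (- (sg g * r * P s))) (at 0)"
      and tan: "((\<lambda>e. (1 / mnorm g (Gs e (q e))) *\<^sub>R Gs e (q e)) has_vector_derivative
          fr ((h * (P' s / \<omega> s) - A) / r * cos (\<theta> s)) ((h * (P' s / \<omega> s) - A) / r * sin (\<theta> s)) (- (sg g * (P' s / \<omega> s)))) (at 0)"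
      if q: "(q has_vector_derivative a) (at 0)" and s: "s = q 0" and A: "A = Q s + a * r * \<omega> s" for q a s A
    proof -
      have "((\<lambda>e. G e (q e)) has_vector_derivative 1 *\<^sub>R Ge 0 s + a *\<^sub>R Gs 0 s) (at 0)"
        unfolding s by (rule has_vector_derivative_curve[OF G _ q]) simp
      moreover have "1 *\<^sub>R Ge 0 s + a *\<^sub>R Gs 0 s =
          fr (h * P s * cos (\<theta> s) - A * sin (\<theta> s)) (h * P s * sin (\<theta> s) + A * cos (\<theta> s)) (- (sg g * r * P s))"
        unfolding V Gs0 fr_arith fr_eq_iff A by (simp add: algebra_simps)
      ultimately show "((\<lambda>e. G e (q e)) has_vector_derivative
          fr (h * P s * cos (\<theta> s) - A * sin (\<theta> s)) (h * P s * sin (\<theta> s) + A * cos (\<theta> s)) (- (sg g * r * P s))) (at 0)"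
        by simp
      have X: "((\<lambda>e. Gs e (q e)) has_vector_derivative 1 *\<^sub>R Gse 0 s + a *\<^sub>R Gss 0 s) (at 0)"
        unfolding s by (rule has_vector_derivative_curve[OF Gs _ q]) simp
      from has_vector_derivative_unit_tangent[OF X reg[OF zero\<delta>]]
      show "((\<lambda>e. (1 / mnorm g (Gs e (q e))) *\<^sub>R Gs e (q e)) has_vector_derivative
          fr ((h * (P' s / \<omega> s) - A) / r * cos (\<theta> s)) ((h * (P' s / \<omega> s) - A) / r * sin (\<theta> s)) (- (sg g * (P' s / \<omega> s)))) (at 0)"
        unfolding s[symmetric] scaleR_one W Gss0 Gs0 A unit_tangent_variation(3)[OF r \<omega>pos] .
    qed
    define x where "x e = G e (\<phi> e t)" for e
    define y where "y e = G e (\<psi> e t)" for e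
    define \<tau>x where "\<tau>x e = (1 / mnorm g (Gs e (\<phi> e t))) *\<^sub>R Gs e (\<phi> e t)" for e
    define \<tau>y where "\<tau>y e = (1 / mnorm g (Gs e (\<psi> e t))) *\<^sub>R Gs e (\<psi> e t)" for e
    define S where "S = (\<lambda>e. sqrt (sg g * (1 - (ip g (x e) (y e))\<^sup>2)))"
    note dx = pt[OF q\<phi> s1_def refl] and dy = pt[OF q\<psi> s2_def refl]
      and d\<tau>x = tan[OF q\<phi> s1_def refl] and d\<tau>y = tan[OF q\<psi> s2_def refl]
    have x0: "x 0 = fr (r * cos u) (r * sin u) h" and y0: "y 0 = fr (r * cos v) (r * sin v) h"
      by (simp_all only: x_def y_def v_def s1_def[symmetric] s2_def[symmetric] G0 u)
    have \<tau>x0: "\<tau>x 0 = fr (- sin u) (cos u) 0" and \<tau>y0: "\<tau>y 0 = fr (- sin v) (cos v) 0"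
      unfolding \<tau>x_def \<tau>y_def v_def s1_def[symmetric] s2_def[symmetric] Gs0 u[symmetric]
      by (rule unit_tangent_variation(2)[OF r \<omega>pos])+
    have ne: "cos (v - u) \<noteq> 1"
      using chords zero\<delta> x0 y0 unfolding x_def y_def by (intro circle_chord(4)[OF rh]) metis
    have S0: "S 0 = sqrt (r\<^sup>2 * ((sin (v - u))\<^sup>2 + (h * (1 - cos (v - u)))\<^sup>2))"
      unfolding S_def x0 y0 circle_chord(1)[OF rh] ..
    \<comment> \<open>The strict inequality says that no chord of the circle is tangent to it; it
      rests on h being nonzero.\<close>
    have "\<bar>r * sin (v - u)\<bar> = sqrt (r\<^sup>2 * (sin (v - u))\<^sup>2)"
      by (simp add: real_sqrt_mult abs_mult)
    also have "\<dots> < S 0" unfolding S0 using r h(2) ne by (intro real_sqrt_less_mono mult_strict_left_mono) auto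
    finally have small: "\<bar>r * sin (v - u)\<bar> < S 0" .
    have ax: "\<bar>arccos (ip g (\<tau>x e) (y e) / S e) - \<alpha>\<bar> \<le> C * e\<^sup>2"
      and ay: "\<bar>arccos (- ip g (x e) (\<tau>y e) / S e) - \<alpha>\<bar> \<le> C * e\<^sup>2" if e: "\<bar>e\<bar> < \<delta>" for e
    proof -
      have "\<bar>angle_x g G \<phi> \<psi> e t - \<alpha>\<bar> \<le> C * e\<^sup>2" and "\<bar>angle_y g G \<phi> \<psi> e t - \<alpha>\<bar> \<le> C * e\<^sup>2"
        using angles e by blast+
      note a = this and mc = mangle_chord[OF onM[OF e] onM[OF e] tangG[OF e]]
      show "\<bar>arccos (ip g (\<tau>x e) (y e) / S e) - \<alpha>\<bar> \<le> C * e\<^sup>2"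
        using a(1) unfolding angle_x_def d_s mc \<tau>x_def S_def x_def y_def .
      show "\<bar>arccos (- ip g (x e) (\<tau>y e) / S e) - \<alpha>\<bar> \<le> C * e\<^sup>2"
        using a(2) unfolding angle_y_def d_s mc \<tau>y_def S_def x_def y_def
          ip_commute[of g "G e (\<psi> e t)" "G e (\<phi> e t)"] .
    qed
    \<comment> \<open>At e = 0 the error bound is zero, so the circle has contact angle \<alpha>
      exactly, which fixes v - u modulo 2 pi.\<close>
    have "arccos (r * sin (v - u) / S 0) = \<alpha>"
      using ax[OF zero\<delta>] unfolding \<tau>x0 y0 circle_chord(2)[OF rh] by simp
    then have sin: "sin (v - u) = m * (1 - cos (v - u))"
      unfolding S0 m_def by (rule contact_angle_cot[OF r h(2) ne])
    have "h * ((P' s1 / \<omega> s1 + P' s2 / \<omega> s2) * (1 - cos (v - u))) = h * (sin (v - u) * (P s2 - P s1))"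
    proof (rule linearized_equal_angles[OF r])
      show "ip g (fr (- sin u) (cos u) 0) (fr (h * P s2 * cos v - (Q s2 + \<psi>e 0 t * r * \<omega> s2) * sin v)
            (h * P s2 * sin v + (Q s2 + \<psi>e 0 t * r * \<omega> s2) * cos v) (- (sg g * r * P s2)))
        + ip g (fr ((h * (P' s1 / \<omega> s1) - (Q s1 + \<phi>e 0 t * r * \<omega> s1)) / r * cos u)
            ((h * (P' s1 / \<omega> s1) - (Q s1 + \<phi>e 0 t * r * \<omega> s1)) / r * sin u) (- (sg g * (P' s1 / \<omega> s1))))
          (fr (r * cos v) (r * sin v) h)
        + (ip g (fr (r * cos u) (r * sin u) h)
            (fr ((h * (P' s2 / \<omega> s2) - (Q s2 + \<psi>e 0 t * r * \<omega> s2)) / r * cos v)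
              ((h * (P' s2 / \<omega> s2) - (Q s2 + \<psi>e 0 t * r * \<omega> s2)) / r * sin v) (- (sg g * (P' s2 / \<omega> s2))))
          + ip g (fr (h * P s1 * cos u - (Q s1 + \<phi>e 0 t * r * \<omega> s1) * sin u)
              (h * P s1 * sin u + (Q s1 + \<phi>e 0 t * r * \<omega> s1) * cos u) (- (sg g * r * P s1)))
            (fr (- sin v) (cos v) 0)) = 0"
        unfolding x0[symmetric] y0[symmetric] \<tau>x0[symmetric] \<tau>y0[symmetric]
      proof (rule equal_angles_first_order[OF _ _ _ _ \<delta> S_def _ _ _ ax ay])
        show "(x has_vector_derivative fr (h * P s1 * cos u - (Q s1 + \<phi>e 0 t * r * \<omega> s1) * sin u)
              (h * P s1 * sin u + (Q s1 + \<phi>e 0 t * r * \<omega> s1) * cos u) (- (sg g * r * P s1))) (at 0)"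
          using dx unfolding x_def[abs_def] u .
        show "(y has_vector_derivative fr (h * P s2 * cos v - (Q s2 + \<psi>e 0 t * r * \<omega> s2) * sin v)
            (h * P s2 * sin v + (Q s2 + \<psi>e 0 t * r * \<omega> s2) * cos v) (- (sg g * r * P s2))) (at 0)"
          using dy unfolding y_def[abs_def] v_def .
        show "(\<tau>x has_vector_derivative fr ((h * (P' s1 / \<omega> s1) - (Q s1 + \<phi>e 0 t * r * \<omega> s1)) / r * cos u)
            ((h * (P' s1 / \<omega> s1) - (Q s1 + \<phi>e 0 t * r * \<omega> s1)) / r * sin u) (- (sg g * (P' s1 / \<omega> s1)))) (at 0)"
          using d\<tau>x unfolding \<tau>x_def[abs_def] u .
        show "(\<tau>y has_vector_derivative fr ((h * (P' s2 / \<omega> s2) - (Q s2 + \<psi>e 0 t * r * \<omega> s2)) / r * cos v)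
              ((h * (P' s2 / \<omega> s2) - (Q s2 + \<psi>e 0 t * r * \<omega> s2)) / r * sin v) (- (sg g * (P' s2 / \<omega> s2)))) (at 0)"
          using d\<tau>y unfolding \<tau>y_def[abs_def] v_def .
        show "S 0 > 0" using small by linarith
        show "\<bar>ip g (\<tau>x 0) (y 0)\<bar> < S 0" "\<bar>ip g (x 0) (\<tau>y 0)\<bar> < S 0"
          unfolding \<tau>x0 \<tau>y0 x0 y0 circle_chord(2,3)[OF rh] using small by simp_all
      qed
    qed
    then have lin: "(P' s1 / \<omega> s1 + P' s2 / \<omega> s2) * (1 - cos (v - u)) = m * (P s2 - P s1) * (1 - cos (v - u))"
      using h(2) unfolding sin by (simp add: mult_ac)
    have "p' u + p' v = m * (p v - p u)"
      using lin ne unfolding p_def p'_def u[symmetric] v_def J by simp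
    \<comment> \<open>The central angle is found only modulo 2 pi; the periodicity of p and
      \<open>p'\<close> absorbs the multiple n.\<close>
    moreover obtain n :: int where n: "v - u = 2 * \<gamma> + 2 * pi * n"
      by (rule eq_double_angle[OF sin ne \<gamma>' \<gamma>(2)]) (rule that)
    have pper': "p' (w + 2 * pi) = p' w" for w
    proof (rule DERIV_unique[OF _ p])
      show "(p has_real_derivative p' (w + 2 * pi)) (at w)"
        using p[of "w + 2 * pi"] unfolding DERIV_shift[of p] pper .
    qed
    interpret p: periodic_fun_simple p "2 * pi" by unfold_locales (rule pper)
    interpret p': periodic_fun_simple p' "2 * pi" by unfold_locales (rule pper')
    have "v = u + 2 * \<gamma> + of_int n * (2 * pi)" using n by (simp add: algebra_simps)
    then have "p v = p (u + 2 * \<gamma>)" "p' v = p' (u + 2 * \<gamma>)"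
      by (simp_all only: p.plus_of_int p'.plus_of_int)
    ultimately show ?thesis by simp
  qed

  \<comment> \<open>Constancy of the curvature variation in the absence of resonance\<close>
  obtain a b d where abd: "\<And>u. p u = a + b * cos u + d * sin u"
  proof (rule functional_equation_imp_trigonometric[OF p contp' pper feq])
    show "real k * cos (real k * \<gamma>) \<noteq> m * sin (real k * \<gamma>)" if "k \<ge> 2" for k
      using no that unfolding m_def by blast
  qed (rule that)
  have P_eq: "P s = a + b * cos (\<theta> s) + d * sin (\<theta> s)" for s
    using abd[of "\<theta> s"] unfolding p_def J .
  have P'_eq: "P' s = \<omega> s * (d * cos (\<theta> s) - b * sin (\<theta> s))" for s
  proof (rule DERIV_unique[OF P])
    show "(P has_real_derivative \<omega> s * (d * cos (\<theta> s) - b * sin (\<theta> s))) (at s)"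
      unfolding P_eq[abs_def]
      by (rule derivative_eq_intros \<theta> refl)+ (simp add: algebra_simps)
  qed
  have P''_eq: "P'' s = \<omega>' s * (d * cos (\<theta> s) - b * sin (\<theta> s)) - (\<omega> s)\<^sup>2 * (b * cos (\<theta> s) + d * sin (\<theta> s))" for s
  proof (rule DERIV_unique[OF P'])
    show "(P' has_real_derivative
        \<omega>' s * (d * cos (\<theta> s) - b * sin (\<theta> s)) - (\<omega> s)\<^sup>2 * (b * cos (\<theta> s) + d * sin (\<theta> s))) (at s)"
      unfolding P'_eq[abs_def]
      by (rule derivative_eq_intros \<theta> \<omega> refl)+ (simp add: algebra_simps power2_eq_square)
  qed
  have "(P'' s * \<omega> s - \<omega>' s * P' s) / \<omega> s ^ 3 + P s = a" for s
  proof -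
    have "P'' s * \<omega> s - \<omega>' s * P' s = - (b * cos (\<theta> s) + d * sin (\<theta> s)) * \<omega> s ^ 3"
      unfolding P''_eq P'_eq by algebra
    then show ?thesis using \<omega>pos[of s] unfolding P_eq by simp
  qed
  with nonconst show False unfolding curv by simp
qed

theorem theorem1:
  fixes g :: geom and R \<alpha> :: real
  assumes "R > 0" and "0 < \<alpha>" and "\<alpha> \<le> pi"
    and "nontrivial_inf_gutkin_deformation g R \<alpha>"
  shows "\<forall>c::real. cot c = (case g of Sphere \<Rightarrow> cos R | Hyperbolic \<Rightarrow> cosh R) * cot \<alpha> \<longrightarrow>
           (\<exists>k::nat. k \<ge> 2 \<and> real k * tan c = tan (real k * c))"
proof (intro allI impI)
  fix c :: real
  define h where "h = (case g of Sphere \<Rightarrow> cos R | Hyperbolic \<Rightarrow> cosh R)"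
  assume "cot c = (case g of Sphere \<Rightarrow> cos R | Hyperbolic \<Rightarrow> cosh R) * cot \<alpha>"
  then have c: "cot c = h * cot \<alpha>" by (simp only: h_def)
  show "\<exists>k::nat. k \<ge> 2 \<and> real k * tan c = tan (real k * c)"
  \<comment> \<open>The value 0 occurs for great circles, for right contact angles and, as cot pi is
    0 by the convention for division by zero, for \<alpha> = pi. In the other case h, sin c and cos
    c are all nonzero.\<close>
  proof (cases "cot c = 0")
    case True
    \<comment> \<open>Here \<open>c\<close> is a multiple of \<open>pi / 2\<close>, and \<open>tan\<close> vanishes at all such points,
      by the convention \<open>x / 0 = 0\<close> at the odd ones.\<close>
    then have "tan c = 0" "tan (2 * c) = 0" by (auto simp: cot_def tan_def sin_double)
    then show ?thesis by (intro exI[of _ 2]) simp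
  next
    case False
    then have h: "h \<noteq> 0" using c by auto
    from False have sc: "sin c \<noteq> 0" "cos c \<noteq> 0" by (auto simp: cot_def)
    \<comment> \<open>\<open>\<gamma>\<close> is half the central angle of the chords, up to multiples of \<open>pi\<close>; for a spherical circle
      larger than a hemisphere it is the negative of \<open>c\<close>.\<close>
    define \<gamma> where "\<gamma> = sgn h * c"
    have \<gamma>: "sin \<gamma> = sgn h * sin c" "cos \<gamma> = cos c"
      using h by (cases "h > 0"; simp add: \<gamma>_def)+
    have m: "\<bar>h\<bar> * cot \<alpha> * sin (sgn h * x) = cot c * sin x" for x
      using h by (cases "h > 0") (simp_all add: c)
    have "cot c * sin c = cos c" using sc by (simp add: cot_def)
    then have "cos \<gamma> = \<bar>h\<bar> * cot \<alpha> * sin \<gamma>" unfolding \<gamma>_def m using \<gamma>(2) by (simp add: \<gamma>_def)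
    moreover have "sin \<gamma> \<noteq> 0" using sc h by (simp add: \<gamma>(1) sgn_eq_0_iff)
    ultimately obtain k :: nat where k: "k \<ge> 2"
      and res: "real k * cos (real k * \<gamma>) = \<bar>h\<bar> * cot \<alpha> * sin (real k * \<gamma>)"
      using nontrivial_deformation_resonance[OF assms(4) h_def h] by blast
    have "cos (real k * \<gamma>) = cos (real k * c)" using h by (cases "h > 0") (simp_all add: \<gamma>_def)
    with res m[of "real k * c"] have eq: "real k * cos (real k * c) = cot c * sin (real k * c)"
      by (simp add: \<gamma>_def mult.left_commute)
    \<comment> \<open>If this cosine were 0, the resonance with nonzero cot c would make the sine
      vanish too. So tan (k c) is a genuine quotient.\<close>
    have "cos (real k * c) \<noteq> 0"
    proof
      assume 0: "cos (real k * c) = 0"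
      with eq False have "sin (real k * c) = 0" by simp
      with 0 show False using sin_cos_squared_add[of "real k * c"] by simp
    qed
    then have "real k * tan c = tan (real k * c)"
      using eq sc by (simp add: tan_def cot_def field_simps)
    with k show ?thesis by blast
  qed
qed

end
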